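(* Let $k\ge 2$ and $n\ge 1$ be integers. The generic edge-colored $k$-hypergraph with $n$ colors has a transitive extension if and only if $n$ is a power of two.
   Context: **Extensions.** Let $\mathcal M$ be a first-order structure with universe $M$. A one-point extension of $\mathcal M$ is a first-order structure $\mathcal M'$ (in any language) with universe $M\cup\{0\}$, where $0\notin M$ is a new element, such that the stabilizer $\mathrm{Aut}(\mathcal M')_0$ of $0$, acting on $M$, equals $\mathrm{Aut}(\mathcal M)$ as a permutation group on $M$. A transitive extension of $\mathcal M$ is a one-point extension whose automorphism group acts transitively on $M\cup\{0\}$. **Generic structures.** For a Fraïssé class $\mathcal F$ of finitely generated structures, the generic member of $\mathcal F$ is its Fraïssé limit, i.e. the unique (up to isomorphism) countable ultrahomogeneous structure whose age is $\mathcal F$. (Ultrahomogeneous: every isomorphism between finitely generated substructures extends to an automorphism.) **Edge-colored hypergraphs.** A $k$-hyperedge relation on a set $G$ is a $k$-ary relation that is symmetric under all permutations of the $k$ coordinates and irreflexive (it fails on every tuple whose entries are not all distinct). Let $\Delta^k_G$ be the set of $k$-tuples in $G^k$ whose entries are not all distinct. An edge-colored $k$-hypergraph with $n$ colors is a structure $(G,R_1,\dots,R_n)$ where each $R_i$ is a $k$-hyperedge relation on $G$ and $\{R_1,\dots,R_n\}$ is a partition of $G^k\setminus\Delta_G^k$. The generic edge-colored $k$-hypergraph with $n$ colors is the generic member of the class of finite edge-colored $k$-hypergraphs with $n$ colors. The number $1=2^0$ counts as a power of two. *)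

theory Defs
  imports "HOL-Combinatorics.Permutations" "HOL-Library.Countable_Set" "HOL-Library.Disjoint_Sets"
begin

section \<open>First-order structures\<close>

text \<open>Constants are function symbols of arity 0.\<close>

record ('f, 'r) language =
  fun_syms :: "'f set"
  fun_arity :: "'f \<Rightarrow> nat"
  rel_syms :: "'r set"
  rel_arity :: "'r \<Rightarrow> nat"

record ('f, 'r, 'a) fo_structure =
  universe :: "'a set"
  fun_int :: "'f \<Rightarrow> 'a list \<Rightarrow> 'a"
  rel_int :: "'r \<Rightarrow> 'a list set"

definition tuples :: "'a set \<Rightarrow> nat \<Rightarrow> 'a list set" where
  "tuples A n = {xs. set xs \<subseteq> A \<and> length xs = n}"

text \<open>
  Interpretations of symbols outside the language, and values of functions outside the universe,
  are arbitrary; no notion below depends on them. The empty universe is allowed.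
\<close>

definition is_structure :: "('f, 'r) language \<Rightarrow> ('f, 'r, 'a) fo_structure \<Rightarrow> bool" where
  "is_structure L M \<longleftrightarrow>
     (\<forall>f\<in>fun_syms L. \<forall>xs\<in>tuples (universe M) (fun_arity L f). fun_int M f xs \<in> universe M) \<and>
     (\<forall>r\<in>rel_syms L. rel_int M r \<subseteq> tuples (universe M) (rel_arity L r))"

definition embedding ::
  "('f, 'r) language \<Rightarrow> ('f, 'r, 'a) fo_structure \<Rightarrow> ('f, 'r, 'b) fo_structure \<Rightarrow> ('a \<Rightarrow> 'b) \<Rightarrow> bool"
where
  "embedding L A B h \<longleftrightarrow>
     inj_on h (universe A) \<and> h ` universe A \<subseteq> universe B \<and>
     (\<forall>f\<in>fun_syms L. \<forall>xs\<in>tuples (universe A) (fun_arity L f).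
        h (fun_int A f xs) = fun_int B f (map h xs)) \<and>
     (\<forall>r\<in>rel_syms L. \<forall>xs\<in>tuples (universe A) (rel_arity L r).
        xs \<in> rel_int A r \<longleftrightarrow> map h xs \<in> rel_int B r)"

definition isomorphism ::
  "('f, 'r) language \<Rightarrow> ('f, 'r, 'a) fo_structure \<Rightarrow> ('f, 'r, 'b) fo_structure \<Rightarrow> ('a \<Rightarrow> 'b) \<Rightarrow> bool"
where
  "isomorphism L A B h \<longleftrightarrow> embedding L A B h \<and> h ` universe A = universe B"

text \<open>
  Automorphisms are normalised to be the identity outside the universe, so that equality of
  functions is equality of permutations of the universe.
\<close>

definition Aut :: "('f, 'r) language \<Rightarrow> ('f, 'r, 'a) fo_structure \<Rightarrow> ('a \<Rightarrow> 'a) set" where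
  "Aut L M = {g. g permutes universe M \<and> isomorphism L M M g}"


section \<open>One-point extensions\<close>

text \<open>
  The new point is \<^term>\<open>None\<close>, and \<open>M\<close> is identified with its image under \<^term>\<open>Some\<close>. A
  permutation fixing \<^term>\<open>None\<close> and everything outside the universe has the form
  \<open>map_option h\<close>; its action on \<open>M\<close> is \<open>h = (\<lambda>x. the (g (Some x)))\<close>.
\<close>

definition one_point_extension ::
  "('f, 'r) language \<Rightarrow> ('f, 'r, 'a) fo_structure \<Rightarrow>
   ('g, 's) language \<Rightarrow> ('g, 's, 'a option) fo_structure \<Rightarrow> bool"
where
  "one_point_extension L M L' M' \<longleftrightarrow>
     is_structure L' M' \<and>
     universe M' = insert None (Some ` universe M) \<and>
     (\<lambda>g x. the (g (Some x))) ` {g \<in> Aut L' M'. g None = None} = Aut L M"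

definition transitive_extension ::
  "('f, 'r) language \<Rightarrow> ('f, 'r, 'a) fo_structure \<Rightarrow>
   ('g, 's) language \<Rightarrow> ('g, 's, 'a option) fo_structure \<Rightarrow> bool"
where
  "transitive_extension L M L' M' \<longleftrightarrow>
     one_point_extension L M L' M' \<and>
     (\<forall>x\<in>universe M'. \<forall>y\<in>universe M'. \<exists>g\<in>Aut L' M'. g x = y)"

text \<open>
  The language of the extension is arbitrary, but its symbols must come from some type. HOL cannot
  quantify existentially over types, so the types of function and relation symbols are parameters.
  Results about arbitrary languages should leave these types universally quantified; assuming that
  the type of relation symbols is infinite guarantees enough symbols for any countable relational
  language, and every language embeds into one whose symbol types are infinite.
\<close>

definition has_transitive_extension ::
  "'g itself \<Rightarrow> 's itself \<Rightarrow> ('f, 'r) language \<Rightarrow> ('f, 'r, 'a) fo_structure \<Rightarrow> bool"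
where
  "has_transitive_extension _ _ L M \<longleftrightarrow>
     (\<exists>(L' :: ('g, 's) language) M'. transitive_extension L M L' M')"


section \<open>Generic structures\<close>

definition closed_subset :: "('f, 'r) language \<Rightarrow> ('f, 'r, 'a) fo_structure \<Rightarrow> 'a set \<Rightarrow> bool" where
  "closed_subset L M A \<longleftrightarrow>
     A \<subseteq> universe M \<and> (\<forall>f\<in>fun_syms L. \<forall>xs\<in>tuples A (fun_arity L f). fun_int M f xs \<in> A)"

definition generated :: "('f, 'r) language \<Rightarrow> ('f, 'r, 'a) fo_structure \<Rightarrow> 'a set \<Rightarrow> 'a set" where
  "generated L M X = \<Inter> {A. closed_subset L M A \<and> X \<subseteq> A}"

definition substructure :: "('f, 'r, 'a) fo_structure \<Rightarrow> 'a set \<Rightarrow> ('f, 'r, 'a) fo_structure" where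
  "substructure M A = M\<lparr>universe := A, rel_int := (\<lambda>r. rel_int M r \<inter> lists A)\<rparr>"

definition fin_gen_subset :: "('f, 'r) language \<Rightarrow> ('f, 'r, 'a) fo_structure \<Rightarrow> 'a set \<Rightarrow> bool" where
  "fin_gen_subset L M A \<longleftrightarrow> (\<exists>X. finite X \<and> X \<subseteq> universe M \<and> A = generated L M X)"

definition ultrahomogeneous :: "('f, 'r) language \<Rightarrow> ('f, 'r, 'a) fo_structure \<Rightarrow> bool" where
  "ultrahomogeneous L M \<longleftrightarrow>
     (\<forall>A B h. fin_gen_subset L M A \<and> fin_gen_subset L M B \<and>
        isomorphism L (substructure M A) (substructure M B) h \<longrightarrow>
        (\<exists>g\<in>Aut L M. \<forall>x\<in>A. g x = h x))"

text \<open>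
  Classes of countable structures are represented by their members whose universe is a set of
  natural numbers; every countable structure is isomorphic to such a member.
\<close>

definition age :: "('f, 'r) language \<Rightarrow> ('f, 'r, 'a) fo_structure \<Rightarrow> ('f, 'r, nat) fo_structure set"
where
  "age L M = {A. is_structure L A \<and> fin_gen_subset L A (universe A) \<and> (\<exists>h. embedding L A M h)}"

definition generic_member ::
  "('f, 'r) language \<Rightarrow> ('f, 'r, nat) fo_structure set \<Rightarrow> ('f, 'r, 'a) fo_structure \<Rightarrow> bool"
where
  "generic_member L F M \<longleftrightarrow>
     is_structure L M \<and> countable (universe M) \<and> ultrahomogeneous L M \<and> age L M = F"


section \<open>Edge-colored hypergraphs\<close>

definition hyperedge_relation :: "nat \<Rightarrow> 'a set \<Rightarrow> 'a list set \<Rightarrow> bool" where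
  "hyperedge_relation k G R \<longleftrightarrow>
     R \<subseteq> tuples G k \<and>
     (\<forall>p xs. p permutes {..<k} \<and> xs \<in> R \<longrightarrow> permute_list p xs \<in> R) \<and>
     (\<forall>xs\<in>R. distinct xs)"

definition diagonal :: "nat \<Rightarrow> 'a set \<Rightarrow> 'a list set" where
  "diagonal k G = {xs \<in> tuples G k. \<not> distinct xs}"

definition hypergraph_language :: "nat \<Rightarrow> nat \<Rightarrow> ('f, nat) language" where
  "hypergraph_language k n =
     \<lparr>fun_syms = {}, fun_arity = (\<lambda>_. 0), rel_syms = {1..n}, rel_arity = (\<lambda>_. k)\<rparr>"

text \<open>A color class is allowed to be empty, as it must be in a hypergraph with few vertices.\<close>

definition edge_colored_hypergraph :: "nat \<Rightarrow> nat \<Rightarrow> ('f, nat, 'a) fo_structure \<Rightarrow> bool" where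
  "edge_colored_hypergraph k n G \<longleftrightarrow>
     is_structure (hypergraph_language k n) G \<and>
     (\<forall>i\<in>{1..n}. hyperedge_relation k (universe G) (rel_int G i)) \<and>
     disjoint_family_on (rel_int G) {1..n} \<and>
     (\<Union>i\<in>{1..n}. rel_int G i) = tuples (universe G) k - diagonal k (universe G)"

definition generic_edge_colored_hypergraph ::
  "nat \<Rightarrow> nat \<Rightarrow> ('f, nat, 'a) fo_structure \<Rightarrow> bool"
where
  "generic_edge_colored_hypergraph k n G \<longleftrightarrow>
     generic_member (hypergraph_language k n)
       {H. edge_colored_hypergraph k n H \<and> finite (universe H)} G"

end

theory Submission
  imports Defs "HOL-Library.Z2"
begin

text \<open>
  Write \<open>G\<close> also for the universe of the generic hypergraph and \<open>0\<close> for the new point.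

  If \<open>n = 2^m\<close>, identify the colors with vectors in \<open>(\<int>/2)^m\<close>, extend the coloring \<open>c\<close> of the
  \<open>k\<close>-subsets of \<open>G\<close> by zero to the \<open>k\<close>-subsets of \<open>G \<union> {0}\<close>, and let the coboundary \<open>\<delta>c\<close>, a coloring
  of the \<open>(k+1)\<close>-subsets, be the extension. Since \<open>\<delta>\<delta>c = 0\<close>, the coloring \<open>\<delta>c\<close> is determined by its
  restriction to the \<open>(k+1)\<close>-sets through any single point \<open>x\<close>. For \<open>x = 0\<close> this restriction is \<open>c\<close>; for
  every other \<open>x\<close> it is a generic coloring as well, so a back-and-forth argument moves \<open>0\<close> to \<open>x\<close>.

  Conversely, let \<open>H\<close> be the automorphism group of a transitive extension. As \<open>k \<ge> 2\<close>, the \<open>H\<close>-orbits on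
  ordered \<open>(k+1)\<close>-tuples of distinct points are symmetric, so \<open>c\<close> extends to an \<open>H\<close>-invariant coloring \<open>d\<close>
  of the \<open>(k+1)\<close>-subsets of \<open>G \<union> {0}\<close> by \<open>n\<close> colors. In every \<open>(k+2)\<close>-set the colors of all faces but one
  determine the color of the last one. Choose \<open>e\<close> such that some \<open>(k+2)\<close>-set has all faces of color \<open>e\<close>,
  and let \<open>a * b\<close> be the color of the last face when the others have colors \<open>a, b, e, \<dots>, e\<close>. This
  operation is totally symmetric, and since the \<open>k\<close>-subsets of a \<open>(k+2)\<close>-set in \<open>G\<close> can be colored
  arbitrarily, it satisfies \<open>(a * b) * (a * c) = b * c\<close>. Hence the colors form an elementary abelian
  2-group with unit \<open>e\<close>.
\<close>

section \<open>The generic hypergraph as a coloring\<close>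

text \<open>From here on only the coloring of \<open>k\<close>-subsets matters:
  \<open>universal\<close> says that the age contains every finite coloring, and
  \<open>homogeneous\<close> is ultrahomogeneity. The values of \<open>col\<close> on other sets are
  arbitrary.\<close>

locale generic_coloring =
  fixes U :: "'a set" and k n :: nat and col :: "'a set \<Rightarrow> nat"
  assumes k_ge_2: "k \<ge> 2"
    and countable_U: "countable U"
    and col_range: "\<And>e. e \<subseteq> U \<Longrightarrow> card e = k \<Longrightarrow> col e \<in> {1..n}"
    and universal: "\<And>(X :: nat set) f. finite X \<Longrightarrow> (\<And>e. e \<subseteq> X \<Longrightarrow> card e = k \<Longrightarrow> f e \<in> {1..n})
       \<Longrightarrow> \<exists>h. inj_on h X \<and> h ` X \<subseteq> U \<and> (\<forall>e\<subseteq>X. card e = k \<longrightarrow> col (h ` e) = f e)"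
    and homogeneous: "\<And>A h. finite A \<Longrightarrow> A \<subseteq> U \<Longrightarrow> inj_on h A \<Longrightarrow> h ` A \<subseteq> U
       \<Longrightarrow> (\<And>e. e \<subseteq> A \<Longrightarrow> card e = k \<Longrightarrow> col (h ` e) = col e)
       \<Longrightarrow> \<exists>g. g permutes U \<and> (\<forall>e\<subseteq>U. card e = k \<longrightarrow> col (g ` e) = col e) \<and> (\<forall>x\<in>A. g x = h x)"
begin

definition color_auts :: "('a \<Rightarrow> 'a) set" where
  "color_auts = {g. g permutes U \<and> (\<forall>e\<subseteq>U. card e = k \<longrightarrow> col (g ` e) = col e)}"

end

section \<open>From the generic structure to a coloring of \<open>k\<close>-subsets\<close>

lemma hypergraph_language_simps [simp]:
  "fun_syms (hypergraph_language k n) = {}"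
  "rel_syms (hypergraph_language k n) = {1..n}"
  "rel_arity (hypergraph_language k n) r = k"
  by (simp_all add: hypergraph_language_def)

lemma generated_relational:
  assumes "fun_syms L = {}" "X \<subseteq> universe M"
  shows "generated L M X = X"
  using assms unfolding generated_def closed_subset_def by auto

lemma fin_gen_subset_relational:
  assumes "fun_syms L = {}"
  shows "fin_gen_subset L M A \<longleftrightarrow> finite A \<and> A \<subseteq> universe M"
  using assms generated_relational[OF assms] unfolding fin_gen_subset_def by metis

text \<open>Finite induced substructures, relabeled by natural numbers, lie in the age. This is how
  a hypothesis on the age reaches the structure itself.\<close>

lemma finite_pullback_in_age:
  fixes M :: "('f, 'r, 'a) fo_structure" and X :: "nat set"
  assumes L: "fun_syms L = {}" and "finite X" "inj_on h X" "h ` X \<subseteq> universe M"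
  defines "A \<equiv> \<lparr>universe = X, fun_int = undefined,
    rel_int = (\<lambda>r. {xs \<in> tuples X (rel_arity L r). map h xs \<in> rel_int M r})\<rparr>"
  shows "A \<in> age L M"
proof -
  have "embedding L A M h"
    using assms by (auto simp: embedding_def A_def)
  moreover have "is_structure L A"
    using L by (auto simp: is_structure_def A_def)
  moreover have "fin_gen_subset L A (universe A)"
    using assms by (simp add: fin_gen_subset_relational A_def)
  ultimately show ?thesis
    unfolding age_def by blast
qed

text \<open>Genericity only makes the members of the age hypergraphs. Each hypergraph axiom concerns
  the entries of one tuple at a time, so it can be checked in a finite copy of these
  entries.\<close>

lemma generic_is_edge_colored_hypergraph:
  fixes G :: "('f, nat, 'a) fo_structure"
  assumes "generic_edge_colored_hypergraph k n G"
  shows "edge_colored_hypergraph k n G"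
proof -
  let ?L = "hypergraph_language k n :: ('f, nat) language"
  have str: "is_structure ?L G"
    and age: "age ?L G = {H. edge_colored_hypergraph k n H \<and> finite (universe H)}"
    using assms by (auto simp: generic_edge_colored_hypergraph_def generic_member_def)
  have local: "\<exists>(A :: ('f, nat, nat) fo_structure) h ys. edge_colored_hypergraph k n A \<and> xs = map h ys \<and>
      inj_on h (universe A) \<and> ys \<in> tuples (universe A) k \<and>
      (\<forall>i. rel_int A i = {zs \<in> tuples (universe A) k. map h zs \<in> rel_int G i})"
    if xs: "xs \<in> tuples (universe G) k" for xs
  proof -
    \<comment> \<open>Entries may repeat, so the copy can have fewer than \<open>k\<close>
      points.\<close>
    let ?X = "{..<card (set xs)}"
    obtain h where h: "bij_betw h ?X (set xs)"
      using ex_bij_betw_nat_finite[of "set xs"] by (auto simp: atLeast0LessThan)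
    define A :: "('f, nat, nat) fo_structure" where "A = \<lparr>universe = ?X, fun_int = undefined,
      rel_int = (\<lambda>r. {ys \<in> tuples ?X (rel_arity ?L r). map h ys \<in> rel_int G r})\<rparr>"
    have "A \<in> age ?L G"
      unfolding A_def using h xs
      by (intro finite_pullback_in_age) (auto simp: bij_betw_def tuples_def)
    hence "edge_colored_hypergraph k n A"
      using age by auto
    moreover define ys where "ys = map (inv_into ?X h) xs"
    have "xs = map h ys"
      using h by (auto simp: ys_def bij_betw_def f_inv_into_f intro!: map_idI[symmetric])
    moreover have "ys \<in> tuples ?X k"
      using h xs inv_into_into[of _ h ?X]
      by (auto simp: tuples_def ys_def bij_betw_def simp del: lessThan_iff)
    ultimately show ?thesis
      using h by (intro exI[of _ A] exI[of _ h] exI[of _ ys]) (auto simp: A_def bij_betw_def)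
  qed
  have sub: "rel_int G i \<subseteq> tuples (universe G) k" if "i \<in> {1..n}" for i
    using str that by (auto simp: is_structure_def)
  have perm: "permute_list p xs \<in> rel_int G i"
    if i: "i \<in> {1..n}" and p: "p permutes {..<k}" and xs: "xs \<in> rel_int G i" for i p xs
  proof -
    obtain A :: "('f, nat, nat) fo_structure" and h ys
      where A: "edge_colored_hypergraph k n A" "xs = map h ys" "ys \<in> tuples (universe A) k"
        and rel: "\<And>i. rel_int A i = {zs \<in> tuples (universe A) k. map h zs \<in> rel_int G i}"
      using local[of xs] sub[OF i] xs by blast
    have "ys \<in> rel_int A i"
      using A rel xs by simp
    hence "permute_list p ys \<in> rel_int A i"
      using A i p by (auto simp: edge_colored_hypergraph_def hyperedge_relation_def)
    thus ?thesis
      using rel A p by (simp add: permute_list_map tuples_def)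
  qed
  have dist: "distinct xs" if i: "i \<in> {1..n}" and xs: "xs \<in> rel_int G i" for i xs
  proof -
    obtain A :: "('f, nat, nat) fo_structure" and h ys
      where A: "edge_colored_hypergraph k n A" "xs = map h ys" "ys \<in> tuples (universe A) k"
        "inj_on h (universe A)"
        and rel: "\<And>i. rel_int A i = {zs \<in> tuples (universe A) k. map h zs \<in> rel_int G i}"
      using local[of xs] sub[OF i] xs by blast
    have "ys \<in> rel_int A i"
      using A rel xs by simp
    hence "distinct ys"
      using A i by (auto simp: edge_colored_hypergraph_def hyperedge_relation_def)
    thus ?thesis
      using A by (auto simp: distinct_map tuples_def intro: inj_on_subset)
  qed
  have disj: "disjoint_family_on (rel_int G) {1..n}"
    unfolding disjoint_family_on_def
  proof (intro ballI impI equals0I)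
    fix i j xs assume ij: "i \<in> {1..n}" "j \<in> {1..n}" "i \<noteq> j" and xs: "xs \<in> rel_int G i \<inter> rel_int G j"
    obtain A :: "('f, nat, nat) fo_structure" and h ys
      where A: "edge_colored_hypergraph k n A" "xs = map h ys" "ys \<in> tuples (universe A) k"
        and rel: "\<And>i. rel_int A i = {zs \<in> tuples (universe A) k. map h zs \<in> rel_int G i}"
      using local[of xs] sub ij xs by blast
    have "ys \<in> rel_int A i \<inter> rel_int A j"
      using A rel xs by simp
    thus False
      using A ij unfolding edge_colored_hypergraph_def disjoint_family_on_def by blast
  qed
  have "xs \<in> (\<Union>i\<in>{1..n}. rel_int G i)" if xs: "xs \<in> tuples (universe G) k" "distinct xs" for xs
  proof -
    obtain A :: "('f, nat, nat) fo_structure" and h ys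
      where A: "edge_colored_hypergraph k n A" "xs = map h ys" "ys \<in> tuples (universe A) k"
        and rel: "\<And>i. rel_int A i = {zs \<in> tuples (universe A) k. map h zs \<in> rel_int G i}"
      using local[OF xs(1)] by blast
    have "ys \<in> tuples (universe A) k - diagonal k (universe A)"
      using A xs by (auto simp: diagonal_def distinct_map)
    hence "ys \<in> (\<Union>i\<in>{1..n}. rel_int A i)"
      using A by (simp add: edge_colored_hypergraph_def)
    thus ?thesis
      using rel A by auto
  qed
  hence "(\<Union>i\<in>{1..n}. rel_int G i) = tuples (universe G) k - diagonal k (universe G)"
    using sub dist by (fastforce simp: diagonal_def)
  thus ?thesis
    unfolding edge_colored_hypergraph_def hyperedge_relation_def
    using str sub perm dist disj by blast
qed

section \<open>Colors as a function of the vertex set\<close>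

definition edge_color :: "nat \<Rightarrow> ('f, nat, 'a) fo_structure \<Rightarrow> 'a set \<Rightarrow> nat" where
  "edge_color n G e = (SOME i. i \<in> {1..n} \<and> (\<exists>xs\<in>rel_int G i. set xs = e))"

lemma edge_color_range:
  assumes G: "edge_colored_hypergraph k n G" and e: "e \<subseteq> universe G" "card e = k" "k > 0"
  shows "edge_color n G e \<in> {1..n}" "\<exists>xs\<in>rel_int G (edge_color n G e). set xs = e"
proof -
  obtain xs where xs: "set xs = e" "distinct xs"
    using finite_distinct_list[of e] e card_gt_0_iff by metis
  hence "xs \<in> (\<Union>i\<in>{1..n}. rel_int G i)"
    using G e by (auto simp: edge_colored_hypergraph_def tuples_def diagonal_def distinct_card)
  hence "\<exists>i. i \<in> {1..n} \<and> (\<exists>xs\<in>rel_int G i. set xs = e)"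
    using xs by auto
  from someI_ex[OF this] show "edge_color n G e \<in> {1..n}" "\<exists>xs\<in>rel_int G (edge_color n G e). set xs = e"
    unfolding edge_color_def by blast+
qed

text \<open>Symmetry gives all orderings of an edge the same color and disjointness makes this color
  unique, so the choice made in \<open>edge_color\<close> is harmless and the relations can be
  recovered from it.\<close>

lemma rel_int_iff_edge_color:
  assumes G: "edge_colored_hypergraph k n G" and i: "i \<in> {1..n}" and "k > 0"
  shows "xs \<in> rel_int G i \<longleftrightarrow>
    xs \<in> tuples (universe G) k \<and> distinct xs \<and> edge_color n G (set xs) = i" (is "_ \<longleftrightarrow> ?R")
proof -
  have rel: "hyperedge_relation k (universe G) (rel_int G j)" if "j \<in> {1..n}" for j
    using G that by (simp add: edge_colored_hypergraph_def)
  have in_color: "xs \<in> rel_int G (edge_color n G (set xs)) \<and> edge_color n G (set xs) \<in> {1..n}"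
    if xs: "xs \<in> tuples (universe G) k" "distinct xs"
  proof -
    let ?c = "edge_color n G (set xs)"
    have "set xs \<subseteq> universe G" "card (set xs) = k"
      using xs by (auto simp: tuples_def distinct_card)
    with edge_color_range[OF G this \<open>k > 0\<close>] obtain ys
      where c: "?c \<in> {1..n}" and ys: "ys \<in> rel_int G ?c" "set ys = set xs"
      by blast
    have "distinct ys" "length ys = k"
      using rel[OF c] ys by (auto simp: hyperedge_relation_def tuples_def)
    \<comment> \<open>Two enumerations of a set without repetition differ by a permutation of
      positions, under which a color class is closed.\<close>
    hence "mset xs = mset ys"
      using xs ys by (simp add: set_eq_iff_mset_eq_distinct)
    then obtain p where "p permutes {..<length ys}" "permute_list p ys = xs"
      using mset_eq_permutation by blast
    thus ?thesis
      using rel[OF c] ys c \<open>length ys = k\<close> by (auto simp: hyperedge_relation_def)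
  qed
  show ?thesis
  proof
    assume xs: "xs \<in> rel_int G i"
    hence "xs \<in> tuples (universe G) k" "distinct xs"
      using rel[OF i] by (auto simp: hyperedge_relation_def)
    moreover from in_color[OF this] have "edge_color n G (set xs) = i"
      using G i xs unfolding edge_colored_hypergraph_def disjoint_family_on_def by blast
    ultimately show ?R by blast
  next
    assume ?R
    thus "xs \<in> rel_int G i"
      using in_color by blast
  qed
qed

lemma edge_color_eqI:
  assumes G: "edge_colored_hypergraph k n G" and "i \<in> {1..n}" "k > 0" "xs \<in> rel_int G i"
  shows "edge_color n G (set xs) = i"
  using assms rel_int_iff_edge_color by blast

text \<open>A tuple with repeated entries and its image both lie in no color class, so only the
  \<open>k\<close>-subsets impose conditions.\<close>

lemma embedding_hypergraph_iff:
  fixes A :: "('f, nat, 'a) fo_structure" and B :: "('f, nat, 'b) fo_structure"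
  assumes A: "edge_colored_hypergraph k n A" and B: "edge_colored_hypergraph k n B" and "k > 0"
  shows "embedding (hypergraph_language k n) A B h \<longleftrightarrow>
    inj_on h (universe A) \<and> h ` universe A \<subseteq> universe B \<and>
    (\<forall>e\<subseteq>universe A. card e = k \<longrightarrow> edge_color n B (h ` e) = edge_color n A e)" (is "?E \<longleftrightarrow> ?R")
proof
  assume E: ?E
  have "edge_color n B (h ` e) = edge_color n A e" if e: "e \<subseteq> universe A" "card e = k" for e
  proof -
    obtain xs where xs: "set xs = e" "xs \<in> rel_int A (edge_color n A e)" and
      c: "edge_color n A e \<in> {1..n}"
      using edge_color_range[OF A e \<open>k > 0\<close>] by blast
    hence "xs \<in> tuples (universe A) k"
      using rel_int_iff_edge_color[OF A c \<open>k > 0\<close>] by blast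
    hence "map h xs \<in> rel_int B (edge_color n A e)"
      using E xs c by (auto simp: embedding_def)
    from edge_color_eqI[OF B c \<open>k > 0\<close> this] show ?thesis
      using xs by simp
  qed
  thus ?R using E by (auto simp: embedding_def)
next
  assume R: ?R
  have "xs \<in> rel_int A i \<longleftrightarrow> map h xs \<in> rel_int B i"
    if i: "i \<in> {1..n}" and xs: "xs \<in> tuples (universe A) k" for i xs
  proof (cases "distinct xs")
    case True
    have "distinct (map h xs)"
      using R xs True by (auto simp: distinct_map tuples_def intro: inj_on_subset)
    moreover have "map h xs \<in> tuples (universe B) k"
      using R xs by (auto simp: tuples_def)
    moreover have "edge_color n B (h ` set xs) = edge_color n A (set xs)"
      using R xs True by (simp add: tuples_def distinct_card)
    ultimately show ?thesis
      using True xs by (simp add: rel_int_iff_edge_color[OF A i \<open>k > 0\<close>] rel_int_iff_edge_color[OF B i \<open>k > 0\<close>])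
  next
    case False
    hence "\<not> distinct (map h xs)"
      by (simp add: distinct_map)
    with False show ?thesis
      by (simp add: rel_int_iff_edge_color[OF A i \<open>k > 0\<close>] rel_int_iff_edge_color[OF B i \<open>k > 0\<close>])
  qed
  thus ?E using R by (auto simp: embedding_def)
qed

lemma Aut_hypergraph_iff:
  assumes "edge_colored_hypergraph k n G" "k > 0"
  shows "g \<in> Aut (hypergraph_language k n) G \<longleftrightarrow>
    g permutes universe G \<and> (\<forall>e\<subseteq>universe G. card e = k \<longrightarrow> edge_color n G (g ` e) = edge_color n G e)"
  using assms permutes_inj_on[of g "universe G"] permutes_image[of g "universe G"]
  by (auto simp: Aut_def isomorphism_def embedding_hypergraph_iff)

text \<open>The passage back from colorings to hypergraphs; it supplies the members of the age that
  yield \<open>universal\<close>.\<close>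

lemma coloring_hypergraph:
  fixes X :: "'a set" and f :: "'a set \<Rightarrow> nat" and H :: "('f, nat, 'a) fo_structure"
  assumes f: "\<And>e. e \<subseteq> X \<Longrightarrow> card e = k \<Longrightarrow> f e \<in> {1..n}" and "k > 0"
  defines "H \<equiv> \<lparr>universe = X, fun_int = undefined,
    rel_int = (\<lambda>i. {xs \<in> tuples X k. distinct xs \<and> f (set xs) = i})\<rparr>"
  shows "edge_colored_hypergraph k n H"
    and "\<And>e. e \<subseteq> X \<Longrightarrow> card e = k \<Longrightarrow> edge_color n H e = f e"
proof -
  have tup: "permute_list p xs \<in> tuples X k" if "p permutes {..<k}" "xs \<in> tuples X k" for p xs
    using that by (auto simp: tuples_def)
  show H: "edge_colored_hypergraph k n H"
    unfolding edge_colored_hypergraph_def hyperedge_relation_def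
  proof (intro conjI ballI allI impI)
    show "(\<Union>i\<in>{1..n}. rel_int H i) = tuples (universe H) k - diagonal k (universe H)"
      using f by (auto simp: H_def diagonal_def tuples_def distinct_card)
  qed (auto simp: H_def is_structure_def disjoint_family_on_def tup, auto simp: tuples_def)
  show "edge_color n H e = f e" if e: "e \<subseteq> X" "card e = k" for e
  proof -
    obtain xs where xs: "set xs = e" "distinct xs"
      using finite_distinct_list[of e] e \<open>k > 0\<close> card_gt_0_iff by metis
    hence "xs \<in> rel_int H (f e)"
      using e by (auto simp: H_def tuples_def distinct_card)
    from edge_color_eqI[OF H f[OF e] \<open>k > 0\<close> this] xs show ?thesis by simp
  qed
qed

lemma generic_coloring_generic_hypergraph:
  fixes G :: "('f, nat, 'a) fo_structure"
  assumes "k \<ge> 2" and gen: "generic_edge_colored_hypergraph k n G"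
  shows "generic_coloring (universe G) k n (edge_color n G)"
proof
  let ?L = "hypergraph_language k n :: ('f, nat) language"
  have G: "edge_colored_hypergraph k n G"
    using gen by (rule generic_is_edge_colored_hypergraph)
  have k: "k > 0" using \<open>k \<ge> 2\<close> by simp
  show "k \<ge> 2" by fact
  show "countable (universe G)"
    using gen by (simp add: generic_edge_colored_hypergraph_def generic_member_def)
  show "edge_color n G e \<in> {1..n}" if "e \<subseteq> universe G" "card e = k" for e
    using edge_color_range[OF G that k] by simp
  show "\<exists>h. inj_on h X \<and> h ` X \<subseteq> universe G \<and> (\<forall>e\<subseteq>X. card e = k \<longrightarrow> edge_color n G (h ` e) = f e)"
    if X: "finite X" and f: "\<And>e. e \<subseteq> X \<Longrightarrow> card e = k \<Longrightarrow> f e \<in> {1..n}" for X :: "nat set" and f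
  proof -
    define H :: "('f, nat, nat) fo_structure" where "H = \<lparr>universe = X, fun_int = undefined,
      rel_int = (\<lambda>i. {xs \<in> tuples X k. distinct xs \<and> f (set xs) = i})\<rparr>"
    have H: "edge_colored_hypergraph k n H" 
      and col: "\<And>e. e \<subseteq> X \<Longrightarrow> card e = k \<Longrightarrow> edge_color n H e = f e"
      unfolding H_def by (intro coloring_hypergraph f k; simp)+
    have "H \<in> age ?L G"
      using gen H X by (simp add: generic_edge_colored_hypergraph_def generic_member_def H_def)
    then obtain h where "embedding ?L H G h"
      by (auto simp: age_def)
    thus ?thesis
      unfolding embedding_hypergraph_iff[OF H G k]
      using col by (intro exI[of _ h]) (auto simp: H_def)
  qed
  show "\<exists>g. g permutes universe G \<and>
      (\<forall>e\<subseteq>universe G. card e = k \<longrightarrow> edge_color n G (g ` e) = edge_color n G e) \<and> (\<forall>x\<in>A. g x = h x)"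
    if A: "finite A" "A \<subseteq> universe G" and h: "inj_on h A" "h ` A \<subseteq> universe G"
      and col: "\<And>e. e \<subseteq> A \<Longrightarrow> card e = k \<Longrightarrow> edge_color n G (h ` e) = edge_color n G e" for A h
  proof -
    \<comment> \<open>Preserving edge colors makes \<open>h\<close> an isomorphism of induced
      substructures, to which ultrahomogeneity applies.\<close>
    have "xs \<in> rel_int G i \<inter> lists A \<longleftrightarrow> map h xs \<in> rel_int G i \<inter> lists (h ` A)"
      if i: "i \<in> {1..n}" and xs: "xs \<in> tuples A k" for i xs
    proof -
      have "distinct (map h xs) \<longleftrightarrow> distinct xs"
        using h xs by (auto simp: distinct_map tuples_def intro: inj_on_subset)
      moreover have "edge_color n G (h ` set xs) = edge_color n G (set xs)" if "distinct xs"
        using col that xs by (simp add: tuples_def distinct_card)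
      ultimately show ?thesis
        using xs A h by (auto simp: rel_int_iff_edge_color[OF G i k] tuples_def)
    qed
    hence "isomorphism ?L (substructure G A) (substructure G (h ` A)) h"
      using h by (simp add: isomorphism_def embedding_def substructure_def)
    moreover have "fin_gen_subset ?L G A" "fin_gen_subset ?L G (h ` A)"
      using A h by (simp_all add: fin_gen_subset_relational)
    ultimately obtain g where "g \<in> Aut ?L G" "\<forall>x\<in>A. g x = h x"
      using gen unfolding generic_edge_colored_hypergraph_def generic_member_def ultrahomogeneous_def
      by blast
    thus ?thesis
      using Aut_hypergraph_iff[OF G k] by blast
  qed
qed

lemma Aut_generic_hypergraph:
  assumes "k \<ge> 2" and "generic_edge_colored_hypergraph k n G"
  shows "Aut (hypergraph_language k n) G =
    generic_coloring.color_auts (universe G) k (edge_color n G)"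
  using Aut_hypergraph_iff[OF generic_is_edge_colored_hypergraph[OF assms(2)]] assms(1)
  by (auto simp: generic_coloring.color_auts_def[OF generic_coloring_generic_hypergraph[OF assms]])

section \<open>Transitive extensions force a power of two\<close>

text \<open>Read \<open>T a b c\<close> as \<open>a * b = c\<close>. The operation is totally
  symmetric, and \<open>main\<close> says \<open>(a * b) * (a * c) = b * c\<close>. This makes
  \<open>C\<close> an elementary abelian 2-group with unit \<open>e\<close>; its order is found by
  doubling subgroups, starting from \<open>{e}\<close>.\<close>

lemma card_power_of_two_if_boolean_relation:
  assumes fin: "finite C" and e: "e \<in> C" and Te: "T e e e"
    and sym1: "\<And>a b c. T a b c \<Longrightarrow> T b a c" and sym2: "\<And>a b c. T a b c \<Longrightarrow> T a c b"
    and func: "\<And>a b c c'. T a b c \<Longrightarrow> T a b c' \<Longrightarrow> c = c'"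
    and main: "\<And>a b c. a \<in> C \<Longrightarrow> b \<in> C \<Longrightarrow> c \<in> C \<Longrightarrow>
      \<exists>p\<in>C. \<exists>q\<in>C. \<exists>r\<in>C. T a b p \<and> T a c q \<and> T b c r \<and> T p q r"
  shows "\<exists>m. card C = 2 ^ m"
proof -
  define f where "f a b = (THE c. T a b c)" for a b
  have fI: "f a b = c" if "T a b c" for a b c
    unfolding f_def using that func by blast
  have Tf: "T a b (f a b)" and f_in: "f a b \<in> C" if "a \<in> C" "b \<in> C" for a b
    using main[OF that that(1)] fI by blast+
  have comm: "f a b = f b a" if "a \<in> C" "b \<in> C" for a b
    using fI sym1 Tf that by metis
  have canc: "f a (f a b) = b" if "a \<in> C" "b \<in> C" for a b
    using fI sym2 Tf that by metis
  have ident: "f (f a b) (f a c) = f b c" if "a \<in> C" "b \<in> C" "c \<in> C" for a b c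
    using main[OF that] fI by metis
  \<comment> \<open>Every \<open>y\<close> equals \<open>z * e\<close> for \<open>z = e * y\<close>,
    so \<open>ident\<close> gives \<open>y * y = (z * e) * (z * e) = e * e = e\<close>.\<close>
  have square: "f y y = e" if "y \<in> C" for y
  proof -
    have "f (f e y) e = y"
      using that e comm canc f_in by metis
    with ident[of "f e y" e e] show ?thesis
      using that e f_in fI[OF Te] by simp
  qed
  have unit: "f a e = a" if "a \<in> C" for a
    using canc[of a a] square that by simp
  \<comment> \<open>This is \<open>(b * a) * (b * (b * c)) = a * (b * c)\<close>, where
    \<open>b * (b * c)\<close> cancels to \<open>c\<close>.\<close>
  have assoc: "f (f a b) c = f a (f b c)" if "a \<in> C" "b \<in> C" "c \<in> C" for a b c
    using ident[of b a "f b c"] canc comm f_in that by metis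
  \<comment> \<open>Induction on the number of elements outside the subgroup \<open>B\<close>: for
    \<open>x\<close> outside, \<open>B\<close> and its coset \<open>x * B\<close> together form a
    subgroup of twice the size.\<close>
  have "\<exists>m. card C = 2 ^ m"
    if "B \<subseteq> C" "e \<in> B" "\<And>a b. a \<in> B \<Longrightarrow> b \<in> B \<Longrightarrow> f a b \<in> B" "card B = 2 ^ j" for B j
    using that
  proof (induction "card C - card B" arbitrary: B j rule: less_induct)
    case less
    show ?case
    proof (cases "B = C")
      case True
      thus ?thesis using less.prems by blast
    next
      case False
      then obtain x where x: "x \<in> C" "x \<notin> B"
        using less.prems by blast
      have BC: "b \<in> C" if "b \<in> B" for b
        using that less.prems by blast
      let ?B = "B \<union> f x ` B"
      have disj: "B \<inter> f x ` B = {}"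
      proof (intro equals0I)
        fix y assume "y \<in> B \<inter> f x ` B"
        then obtain b where b: "b \<in> B" "f x b \<in> B" by blast
        hence "f b (f x b) = x"
          using canc comm BC x by metis
        thus False using b x less.prems(3) by metis
      qed
      have "inj_on (f x) B"
        using canc x BC by (metis inj_onI)
      hence card: "card ?B = 2 ^ Suc j"
        using less.prems disj fin
        by (simp add: card_Un_disjoint card_image finite_subset[of B C])
      have sub: "?B \<subseteq> C"
        using f_in BC x by blast
      have closed: "f a b \<in> ?B" if "a \<in> ?B" "b \<in> ?B" for a b
      proof -
        have 1: "f b (f x b') = f x (f b b')" if "b \<in> B" "b' \<in> B" for b b'
          using assoc comm x BC that f_in by metis
        have 2: "f (f x b) b' = f x (f b b')" if "b \<in> B" "b' \<in> B" for b b'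
          using assoc x BC that by metis
        have 3: "f (f x b) (f x b') = f b b'" if "b \<in> B" "b' \<in> B" for b b'
          using ident x BC that by metis
        show ?thesis
          using that less.prems(3) by (auto simp: 1 2 3)
      qed
      have "card ?B \<le> card C"
        using sub fin card_mono by blast
      moreover have "(0::nat) < 2 ^ j" by simp
      ultimately have "card C - card ?B < card C - card B"
        using card less.prems(4) unfolding power_Suc by linarith
      from less.hyps[OF this sub _ closed card] less.prems(2) show ?thesis
        by blast
    qed
  qed
  from this[of "{e}" 0] show ?thesis
    using e fI[OF Te] by auto
qed

text \<open>The extension is kept only as a permutation group \<open>H\<close>, so its language
  disappears. \<open>H_stab\<close> and \<open>H_extend\<close> say that the stabilizer of
  \<open>None\<close> induces exactly \<open>color_auts\<close> on \<open>U\<close>.\<close>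

locale transitive_color_extension = generic_coloring U k n col
  for U :: "'a set" and k n col +
  fixes H :: "('a option \<Rightarrow> 'a option) set"
  assumes H_permutes: "\<And>h. h \<in> H \<Longrightarrow> h permutes insert None (Some ` U)"
    and H_comp: "\<And>g h. g \<in> H \<Longrightarrow> h \<in> H \<Longrightarrow> g \<circ> h \<in> H"
    and H_inv: "\<And>h. h \<in> H \<Longrightarrow> inv h \<in> H"
    and H_transitive: "\<And>x y. x \<in> insert None (Some ` U) \<Longrightarrow> y \<in> insert None (Some ` U) \<Longrightarrow> \<exists>h\<in>H. h x = y"
    and H_stab: "\<And>g. g \<in> H \<Longrightarrow> g None = None \<Longrightarrow> (\<lambda>x. the (g (Some x))) \<in> color_auts"
    and H_extend: "\<And>u. u \<in> color_auts \<Longrightarrow> \<exists>g\<in>H. g None = None \<and> (\<forall>x\<in>U. g (Some x) = Some (u x))"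
begin

abbreviation \<Omega> :: "'a option set" where "\<Omega> \<equiv> insert None (Some ` U)"

section \<open>The action of \<open>H\<close> on sets of \<open>k + 1\<close> points\<close>

lemma H_in_Omega: "h \<in> H \<Longrightarrow> x \<in> \<Omega> \<Longrightarrow> h x \<in> \<Omega>"
  using H_permutes permutes_in_image by metis

lemma H_image_subset: "h \<in> H \<Longrightarrow> S \<subseteq> \<Omega> \<Longrightarrow> h ` S \<subseteq> \<Omega>"
  using H_in_Omega by (meson image_subset_iff subsetD)

lemma finite_edge: "card e = k \<Longrightarrow> finite e"
  using k_ge_2 card_ge_0_finite[of e] by simp

lemma H_inj: "h \<in> H \<Longrightarrow> inj h"
  using H_permutes permutes_inj by metis

lemma H_eq_iff: "h \<in> H \<Longrightarrow> h x = h y \<longleftrightarrow> x = y"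
  using H_inj by (rule inj_eq)

lemma inv_H [simp]: "h \<in> H \<Longrightarrow> inv h (h x) = x" "h \<in> H \<Longrightarrow> h (inv h x) = x"
  using H_permutes permutes_inverses by metis+

lemma card_H_image: "h \<in> H \<Longrightarrow> card (h ` S) = card S"
  using H_inj by (metis card_image inj_on_subset subset_UNIV)

lemma id_in_H: "id \<in> H"
proof -
  obtain h where "h \<in> H" using H_transitive by blast
  moreover have "h \<circ> inv h = id"
    using \<open>h \<in> H\<close> by (simp add: fun_eq_iff)
  ultimately show ?thesis using H_comp H_inv by metis
qed

lemma these_subset: "S \<subseteq> \<Omega> \<Longrightarrow> Option.these S \<subseteq> U"
  by (auto simp: in_these_eq)

lemma insert_None_these: "None \<in> S \<Longrightarrow> insert None (Some ` Option.these S) = S"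
  by (auto simp: Some_image_these_eq)

lemma card_these:
  assumes "None \<in> S" "card S = Suc m"
  shows "card (Option.these S) = m"
proof -
  have "finite S" using assms card_ge_0_finite[of S] by simp
  hence "finite (insert None (Some ` Option.these S))"
    by (simp only: insert_None_these[OF assms(1)])
  hence "finite (Some ` Option.these S)"
    by (simp only: finite_insert)
  hence "card (insert None (Some ` Option.these S)) = Suc (card (Option.these S))"
    by (subst card_insert_disjoint) (auto simp: card_image)
  thus ?thesis using insert_None_these[OF assms(1)] assms by simp
qed

text \<open>\<open>Option.these\<close> deletes \<open>None\<close>: the \<open>(k+1)\<close>-sets
  through \<open>None\<close> correspond to the edges in \<open>U\<close>, on which the stabilizer
  acts by color automorphisms.\<close>

lemma col_stabilizer:
  assumes g: "g \<in> H" "g None = None" and S: "S \<subseteq> \<Omega>" "None \<in> S" "card S = Suc k"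
  shows "col (Option.these (g ` S)) = col (Option.these S)"
proof -
  have some: "g (Some x) = Some (the (g (Some x)))" for x
    using H_eq_iff[OF g(1), of "Some x" None] g(2) by (cases "g (Some x)") auto
  have "g ` insert None (Some ` Option.these S) =
      insert (g None) ((\<lambda>x. g (Some x)) ` Option.these S)"
    by (simp only: image_insert image_image)
  also have "(\<lambda>x. g (Some x)) ` Option.these S = Some ` (\<lambda>x. the (g (Some x))) ` Option.these S"
    unfolding image_image using some by (rule image_cong[OF refl])
  finally have "g ` S = insert None (Some ` (\<lambda>x. the (g (Some x))) ` Option.these S)"
    unfolding insert_None_these[OF S(2)] g(2) .
  hence "Option.these (g ` S) = (\<lambda>x. the (g (Some x))) ` Option.these S"
    by simp
  thus ?thesis
    using H_stab[OF g] these_subset[OF S(1)] card_these[OF S(2,3)] by (simp add: color_auts_def)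
qed

text \<open>
  Here \<open>k \<ge> 2\<close> enters: after moving a third point \<open>r\<close> of \<open>S\<close> to \<^term>\<open>None\<close>, a symmetry of a single
  edge swaps the images of \<^term>\<open>None\<close> and \<open>y\<close>.
\<close>

lemma H_setwise_transitive:
  assumes S: "S \<subseteq> \<Omega>" "None \<in> S" "card S = Suc k" and y: "y \<in> S"
  shows "\<exists>v\<in>H. v ` S = S \<and> v y = None"
proof (cases y)
  case None
  thus ?thesis using id_in_H by (intro bexI[of _ id]) auto
next
  case (Some a)
  have "card (S - {None, y}) > 0"
    using S y Some k_ge_2 by (subst card_Diff_subset) auto
  then obtain r where r: "r \<in> S" "r \<noteq> None" "r \<noteq> y"
    by (auto simp: card_gt_0_iff)
  obtain g where g: "g \<in> H" "g r = None"
    using H_transitive r S by blast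
  let ?S = "g ` S"
  have gS: "?S \<subseteq> \<Omega>" "None \<in> ?S" "card ?S = Suc k"
    using H_image_subset[OF g(1) S(1)] g(2) r(1) card_H_image[OF g(1)] S(3) by force+
  have "g None \<noteq> None" "g y \<noteq> None"
    using H_eq_iff[OF g(1), of None r] H_eq_iff[OF g(1), of y r] g(2) r by simp_all
  then obtain p q where pq: "g None = Some p" "g y = Some q"
    by blast
  let ?e = "Option.these ?S"
  have e: "?e \<subseteq> U" "card ?e = k"
    using these_subset[OF gS(1)] card_these[OF gS(2,3)] by auto
  have pqe: "p \<in> ?e" "q \<in> ?e"
    using pq S(2) y by (force simp: in_these_eq)+
  have fin: "finite ?e"
    using e finite_edge by blast
  let ?t = "Transposition.transpose p q"
  have im: "?t ` ?e = ?e"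
    using pqe by (simp add: transpose_image_eq)
  \<comment> \<open>The only \<open>k\<close>-subset of the edge \<open>?e\<close> is
    \<open>?e\<close> itself, which the transposition preserves; so homogeneity extends the
    transposition to a color automorphism.\<close>
  have "\<exists>u. u permutes U \<and> (\<forall>e\<subseteq>U. card e = k \<longrightarrow> col (u ` e) = col e) \<and> (\<forall>x\<in>?e. u x = ?t x)"
  proof (rule homogeneous)
    show "col (?t ` e') = col e'" if "e' \<subseteq> ?e" "card e' = k" for e'
      using that e fin im by (metis card_subset_eq)
  qed (use fin e im in \<open>auto intro: inj_on_subset[OF inj_transpose]\<close>)
  then obtain u where u: "u \<in> color_auts" "\<forall>x\<in>?e. u x = ?t x"
    by (auto simp: color_auts_def)
  obtain g2 where g2: "g2 \<in> H" "g2 None = None" "\<forall>x\<in>U. g2 (Some x) = Some (u x)"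
    using H_extend[OF u(1)] by blast
  have "g2 ` Some ` ?e = Some ` ?t ` ?e"
    unfolding image_image using g2 u e by (intro image_cong) auto
  hence "g2 ` ?S = ?S"
    using insert_None_these[OF gS(2)] g2(2) im by (metis image_insert)
  hence "(inv g \<circ> g2 \<circ> g) ` S = S"
    using g by (simp only: image_comp[symmetric]) (simp add: image_image)
  \<comment> \<open>Under \<open>g\<close> the points \<open>None\<close> and \<open>y\<close>
    become \<open>Some p\<close> and \<open>Some q\<close>, which \<open>g2\<close> swaps.\<close>
  moreover have "(inv g \<circ> g2 \<circ> g) y = None"
    using pq g2 u pqe e inv_H(1)[OF g(1), of None] by auto
  ultimately show ?thesis
    using H_comp H_inv g g2 by (intro bexI[of _ "inv g \<circ> g2 \<circ> g"]) auto
qed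

text \<open>Following \<open>w\<close> by an element that preserves the image of \<open>S\<close>
  and sends \<open>w None\<close> back to \<open>None\<close> reduces the claim to the stabilizer of
  \<open>None\<close>.\<close>

lemma col_orbit:
  assumes S: "S \<subseteq> \<Omega>" "None \<in> S" "card S = Suc k" and w: "w \<in> H" "None \<in> w ` S"
  shows "col (Option.these (w ` S)) = col (Option.these S)"
proof -
  have wS: "w ` S \<subseteq> \<Omega>" "card (w ` S) = Suc k"
    using H_image_subset[OF w(1) S(1)] S card_H_image[OF w(1)] by auto
  obtain v where v: "v \<in> H" "v ` w ` S = w ` S" "v (w None) = None"
    using H_setwise_transitive[OF wS(1) w(2) wS(2)] S(2) by blast
  have "col (Option.these ((v \<circ> w) ` S)) = col (Option.these S)"
    using v w S by (intro col_stabilizer H_comp) auto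
  moreover have "(v \<circ> w) ` S = w ` S"
    using v(2) by (simp only: image_comp)
  ultimately show ?thesis by simp
qed

section \<open>The \<open>H\<close>-invariant coloring of \<open>(k+1)\<close>-sets that extends
  \<open>col\<close>\<close>

definition d :: "'a option set \<Rightarrow> nat" where
  "d S = (THE i. \<exists>h\<in>H. None \<in> h ` S \<and> col (Option.these (h ` S)) = i)"

text \<open>Two ways \<open>g\<close> and \<open>h\<close> of moving \<open>S\<close> onto a set
  through \<open>None\<close> differ by \<open>g \<circ> inv h\<close>, to which
  \<open>col_orbit\<close> applies; hence \<open>d\<close> is well defined.\<close>

lemma d_eq:
  assumes S: "S \<subseteq> \<Omega>" "card S = Suc k" and h: "h \<in> H" "None \<in> h ` S"
  shows "d S = col (Option.these (h ` S))"
  unfolding d_def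
proof (rule the_equality)
  show "\<exists>g\<in>H. None \<in> g ` S \<and> col (Option.these (g ` S)) = col (Option.these (h ` S))"
    using h by blast
  fix i assume "\<exists>g\<in>H. None \<in> g ` S \<and> col (Option.these (g ` S)) = i"
  then obtain g where g: "g \<in> H" "None \<in> g ` S" "col (Option.these (g ` S)) = i"
    by blast
  have "(g \<circ> inv h) ` h ` S = g ` S"
    using h by (simp add: image_image)
  moreover have "h ` S \<subseteq> \<Omega>" "card (h ` S) = Suc k"
    using S H_image_subset[OF h(1) S(1)] card_H_image[OF h(1)] by auto
  ultimately show "i = col (Option.these (h ` S))"
    using col_orbit[of "h ` S" "g \<circ> inv h"] g h H_comp H_inv by simp
qed

lemma d_None:
  assumes "S \<subseteq> \<Omega>" "card S = Suc k" "None \<in> S"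
  shows "d S = col (Option.these S)"
  using d_eq[OF assms(1,2) id_in_H] assms(3) by simp

lemma d_insert_None:
  assumes "e \<subseteq> U" "card e = k"
  shows "d (insert None (Some ` e)) = col e"
proof -
  have "finite e" using assms(2) by (rule finite_edge)
  hence "card (insert None (Some ` e)) = Suc k"
    using assms by (subst card_insert_disjoint) (auto simp: card_image)
  thus ?thesis using assms by (subst d_None) auto
qed

lemma ex_move_to_None:
  assumes S: "S \<subseteq> \<Omega>" "card S = Suc k"
  shows "\<exists>h\<in>H. None \<in> h ` S"
proof -
  obtain x where "x \<in> S" using S by fastforce
  then obtain h where "h \<in> H" "h x = None"
    using S H_transitive by blast
  thus ?thesis using \<open>x \<in> S\<close> by (intro bexI[of _ h]) (auto intro: rev_image_eqI)
qed

lemma d_H_image: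
  assumes S: "S \<subseteq> \<Omega>" "card S = Suc k" and h: "h \<in> H"
  shows "d (h ` S) = d S"
proof -
  have hS: "h ` S \<subseteq> \<Omega>" "card (h ` S) = Suc k"
    using S H_image_subset[OF h(1) S(1)] card_H_image[OF h(1)] by auto
  obtain g where g: "g \<in> H" "None \<in> g ` h ` S"
    using ex_move_to_None[OF hS] by blast
  have "d S = col (Option.these ((g \<circ> h) ` S))"
    using g h S H_comp by (intro d_eq) (auto simp: image_comp)
  thus ?thesis
    using d_eq[OF hS g] by (simp add: image_comp)
qed

lemma d_range:
  assumes S: "S \<subseteq> \<Omega>" "card S = Suc k"
  shows "d S \<in> {1..n}"
proof -
  obtain h where h: "h \<in> H" "None \<in> h ` S"
    using ex_move_to_None[OF S] by blast
  have "h ` S \<subseteq> \<Omega>" "card (h ` S) = Suc k"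
    using S H_image_subset[OF h(1) S(1)] card_H_image[OF h(1)] by auto
  thus ?thesis
    using d_eq[OF S h] h col_range these_subset card_these by metis
qed

text \<open>Moving \<open>x\<close> and \<open>h x\<close> to \<open>None\<close> turns the
  \<open>(k+1)\<close>-sets through them into edges of \<open>U\<close>, where homogeneity extends
  the map. This is why only the sets \<open>S\<close> through the single point \<open>x\<close> have
  to be tested.\<close>

lemma extend_to_H:
  assumes X: "finite X" "X \<subseteq> \<Omega>" and h: "inj_on h X" "h ` X \<subseteq> \<Omega>" and x: "x \<in> X"
    and d: "\<And>S. S \<subseteq> X \<Longrightarrow> x \<in> S \<Longrightarrow> card S = Suc k \<Longrightarrow> d (h ` S) = d S"
  shows "\<exists>g\<in>H. \<forall>y\<in>X. g y = h y"
proof -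
  obtain g1 where g1: "g1 \<in> H" "g1 x = None"
    using H_transitive[of x None] X(2) x by blast
  obtain g2 where g2: "g2 \<in> H" "g2 (h x) = None"
    using H_transitive[of "h x" None] h(2) x by blast
  define A where "A = Option.these (g1 ` X)"
  \<comment> \<open>\<open>\<psi>\<close> is \<open>h\<close> in coordinates where both
    \<open>x\<close> and \<open>h x\<close> are \<open>None\<close>; \<open>\<phi>\<close> is its
    action on the remaining points.\<close>
  define \<psi> where "\<psi> y = g2 (h (inv g1 y))" for y
  define \<phi> where "\<phi> a = the (\<psi> (Some a))" for a
  have A: "Some a \<in> g1 ` X" "inv g1 (Some a) \<in> X" "inv g1 (Some a) \<noteq> x" if "a \<in> A" for a
  proof -
    show a: "Some a \<in> g1 ` X"
      using that by (simp add: A_def in_these_eq)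
    then obtain y where "y \<in> X" "Some a = g1 y" by blast
    thus "inv g1 (Some a) \<in> X" "inv g1 (Some a) \<noteq> x"
      using g1 by auto
  qed
  have \<psi>: "\<psi> (Some a) = Some (\<phi> a)" "\<phi> a \<in> U" if "a \<in> A" for a
  proof -
    have "h (inv g1 (Some a)) \<noteq> h x"
      using A[OF that] inj_on_eq_iff[OF h(1) _ x] by simp
    hence "\<psi> (Some a) \<noteq> None"
      unfolding \<psi>_def using H_eq_iff[OF g2(1), of _ "h x"] g2(2) by simp
    moreover have "\<psi> (Some a) \<in> \<Omega>"
      unfolding \<psi>_def using H_in_Omega[OF g2(1)] imageI[OF A(2)[OF that], of h] h(2) by blast
    ultimately show "\<psi> (Some a) = Some (\<phi> a)" "\<phi> a \<in> U"
      by (auto simp: \<phi>_def)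
  qed
  have "\<exists>u. u permutes U \<and> (\<forall>e\<subseteq>U. card e = k \<longrightarrow> col (u ` e) = col e) \<and> (\<forall>a\<in>A. u a = \<phi> a)"
  proof (rule homogeneous)
    have "g1 ` X \<subseteq> \<Omega>" by (rule H_image_subset[OF g1(1) X(2)])
    thus AU: "A \<subseteq> U" unfolding A_def by (rule these_subset)
    have "finite (Some ` A)"
      by (rule finite_subset[OF _ finite_imageI[OF X(1), of g1]]) (use A(1) in blast)
    thus "finite A" by (simp add: finite_image_iff)
    show "\<phi> ` A \<subseteq> U" using \<psi>(2) by blast
    show "inj_on \<phi> A"
    proof (rule inj_onI)
      fix a b assume ab: "a \<in> A" "b \<in> A" "\<phi> a = \<phi> b"
      hence "\<psi> (Some a) = \<psi> (Some b)" by (simp add: \<psi>)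
      hence "h (inv g1 (Some a)) = h (inv g1 (Some b))"
        unfolding \<psi>_def using H_eq_iff[OF g2(1)] by simp
      hence "inv g1 (Some a) = inv g1 (Some b)"
        using inj_onD[OF h(1)] A(2) ab by blast
      hence "g1 (inv g1 (Some a)) = g1 (inv g1 (Some b))" by (rule arg_cong)
      thus "a = b" using g1(1) by simp
    qed
    fix e assume e: "e \<subseteq> A" "card e = k"
    have fe: "finite e" using e finite_edge by blast
    \<comment> \<open>The edge \<open>e\<close> together with \<open>None\<close> pulls back to a
      set through \<open>x\<close>, where the assumption on \<open>d\<close> is available.\<close>
    define S where "S = inv g1 ` insert None (Some ` e)"
    have g1S: "g1 ` S = insert None (Some ` e)"
      unfolding S_def using g1 by (simp only: image_image inv_H image_ident)
    have invx: "inv g1 None = x" using inv_H(1)[OF g1(1), of x] g1(2) by simp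
    have S: "S \<subseteq> X" "x \<in> S"
      unfolding S_def using A e invx x by auto
    have cS: "card S = Suc k"
      using card_H_image[OF g1(1), of S] fe e unfolding g1S
      by (subst (asm) card_insert_disjoint) (auto simp: card_image)
    have "g2 ` h ` S = insert None ((\<lambda>a. \<psi> (Some a)) ` e)"
      unfolding S_def \<psi>_def using invx g2 by (simp add: image_image)
    also have "(\<lambda>a. \<psi> (Some a)) ` e = Some ` \<phi> ` e"
      unfolding image_image using \<psi>(1) e(1) by (intro image_cong) auto
    finally have g2S: "g2 ` h ` S = insert None (Some ` \<phi> ` e)" .
    have chS: "card (h ` S) = Suc k" "h ` S \<subseteq> \<Omega>"
      using card_image[of h S] inj_on_subset[OF h(1) S(1)] cS h(2) S(1) by auto
    have "col (\<phi> ` e) = d (g2 ` h ` S)"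
      unfolding g2S
    proof (rule d_insert_None[symmetric])
      show "\<phi> ` e \<subseteq> U" using \<psi>(2) e(1) by blast
      have "card (insert None (Some ` \<phi> ` e)) = Suc k"
        using card_H_image[OF g2(1), of "h ` S"] chS unfolding g2S by simp
      thus "card (\<phi> ` e) = k"
        using fe by (subst (asm) card_insert_disjoint) (auto simp: card_image)
    qed
    also have "\<dots> = d (g1 ` S)"
      using d_H_image[OF chS(2,1) g2(1)] d[OF S cS] d_H_image[OF _ cS g1(1)] S X by auto
    also have "\<dots> = col e"
      unfolding g1S using e AU by (intro d_insert_None) auto
    finally show "col (\<phi> ` e) = col e" .
  qed
  then obtain u where u: "u \<in> color_auts" "\<forall>a\<in>A. u a = \<phi> a"
    by (auto simp: color_auts_def)
  obtain g where g: "g \<in> H" "g None = None" "\<forall>a\<in>U. g (Some a) = Some (u a)"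
    using H_extend[OF u(1)] by blast
  have "(inv g2 \<circ> g \<circ> g1) y = h y" if "y \<in> X" for y
  proof (cases "g1 y")
    case None
    hence "y = x" using H_eq_iff[OF g1(1), of y x] g1 by simp
    thus ?thesis using g1 g2 g inv_H(1)[OF g2(1), of "h x"] by simp
  next
    case (Some a)
    hence a: "a \<in> A" using imageI[OF that, of g1] by (simp add: A_def in_these_eq)
    have "g1 y \<in> \<Omega>" by (rule H_in_Omega[OF g1(1) subsetD[OF X(2) that]])
    hence "a \<in> U" using Some by auto
    hence "g (Some a) = \<psi> (Some a)" using g u a \<psi> by simp
    also have "\<dots> = g2 (h y)" unfolding \<psi>_def using Some inv_H(1)[OF g1(1), of y] by simp
    finally show ?thesis using Some g2 by simp
  qed
  thus ?thesis
    using H_comp H_inv g g1 g2 by (intro bexI[of _ "inv g2 \<circ> g \<circ> g1"]) auto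
qed

text \<open>The faces opposite points other than \<open>z\<close> are exactly those through
  \<open>z\<close>. Respecting them suffices for \<open>h\<close> to agree on \<open>X\<close> with
  an element of \<open>H\<close>, which then respects the last face too.\<close>

lemma d_face_determined:
  assumes X: "X \<subseteq> \<Omega>" "card X = k + 2" and h: "inj_on h X" "h ` X \<subseteq> \<Omega>" and z: "z \<in> X"
    and faces: "\<And>w. w \<in> X \<Longrightarrow> w \<noteq> z \<Longrightarrow> d (h ` X - {h w}) = d (X - {w})"
  shows "d (h ` X - {h z}) = d (X - {z})"
proof -
  have fin: "finite X" using X card_ge_0_finite[of X] by simp
  have img: "h ` (X - {w}) = h ` X - {h w}" if "w \<in> X" for w
    using h that by (subst inj_on_image_set_diff[of h X]) auto
  have "\<exists>g\<in>H. \<forall>y\<in>X. g y = h y"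
  proof (rule extend_to_H[OF fin X(1) h z])
    fix S assume S: "S \<subseteq> X" "z \<in> S" "card S = Suc k"
    have "card (X - S) = 1"
      using S X fin by (subst card_Diff_subset) (auto intro: finite_subset)
    then obtain w where "X - S = {w}" by (auto simp: card_1_singleton_iff)
    hence "S = X - {w}" "w \<in> X" "w \<noteq> z" using S by auto
    thus "d (h ` S) = d S" using faces img by metis
  qed
  then obtain g where g: "g \<in> H" "\<forall>y\<in>X. g y = h y" by blast
  hence "h ` (X - {z}) = g ` (X - {z})" by (intro image_cong) auto
  moreover have "d (g ` (X - {z})) = d (X - {z})"
    using X z fin g by (intro d_H_image) auto
  ultimately show ?thesis using img z by simp
qed

section \<open>The operation on colors read off from the faces of \<open>(k+2)\<close>-sets\<close>

definition face_relation :: "nat \<Rightarrow> nat \<Rightarrow> nat \<Rightarrow> nat \<Rightarrow> bool" where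
  "face_relation e a b c \<longleftrightarrow> (\<exists>X x y z. X \<subseteq> \<Omega> \<and> card X = k + 2 \<and> x \<in> X \<and> y \<in> X \<and> z \<in> X \<and>
     x \<noteq> y \<and> x \<noteq> z \<and> y \<noteq> z \<and> d (X - {x}) = a \<and> d (X - {y}) = b \<and> d (X - {z}) = c \<and>
     (\<forall>w\<in>X - {x, y, z}. d (X - {w}) = e))"

lemma face_relation_sym1:
  assumes "face_relation e a b c"
  shows "face_relation e b a c"
proof -
  obtain X x y z where "X \<subseteq> \<Omega>" "card X = k + 2" "x \<in> X" "y \<in> X" "z \<in> X"
     "x \<noteq> y" "x \<noteq> z" "y \<noteq> z" "d (X - {x}) = a" "d (X - {y}) = b" "d (X - {z}) = c"
     "\<forall>w\<in>X - {x, y, z}. d (X - {w}) = e"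
    using assms unfolding face_relation_def by blast
  thus ?thesis
    unfolding face_relation_def
    by (intro exI[of _ X] exI[of _ y] exI[of _ x] exI[of _ z]) (simp add: insert_commute)
qed

lemma face_relation_sym2:
  assumes "face_relation e a b c"
  shows "face_relation e a c b"
proof -
  obtain X x y z where "X \<subseteq> \<Omega>" "card X = k + 2" "x \<in> X" "y \<in> X" "z \<in> X"
     "x \<noteq> y" "x \<noteq> z" "y \<noteq> z" "d (X - {x}) = a" "d (X - {y}) = b" "d (X - {z}) = c"
     "\<forall>w\<in>X - {x, y, z}. d (X - {w}) = e"
    using assms unfolding face_relation_def by blast
  thus ?thesis
    unfolding face_relation_def
    by (intro exI[of _ X] exI[of _ x] exI[of _ z] exI[of _ y]) (simp add: insert_commute)
qed

text \<open>A bijection between the two witnessing sets that matches the three marked points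
  respects every face except the one opposite \<open>z\<close>, so \<open>d_face_determined\<close>
  applies.\<close>

lemma face_relation_functional:
  assumes "face_relation e a b c" "face_relation e a b c'"
  shows "c = c'"
proof -
  obtain X x y z where X: "X \<subseteq> \<Omega>" "card X = k + 2" "x \<in> X" "y \<in> X" "z \<in> X"
     "x \<noteq> y" "x \<noteq> z" "y \<noteq> z" "d (X - {x}) = a" "d (X - {y}) = b" "d (X - {z}) = c"
     "\<forall>w\<in>X - {x, y, z}. d (X - {w}) = e"
    using assms(1) unfolding face_relation_def by blast
  obtain X' x' y' z' where X': "X' \<subseteq> \<Omega>" "card X' = k + 2" "x' \<in> X'" "y' \<in> X'" "z' \<in> X'"
     "x' \<noteq> y'" "x' \<noteq> z'" "y' \<noteq> z'" "d (X' - {x'}) = a" "d (X' - {y'}) = b" "d (X' - {z'}) = c'"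
     "\<forall>w\<in>X' - {x', y', z'}. d (X' - {w}) = e"
    using assms(2) unfolding face_relation_def by blast
  have fin: "finite X" "finite X'"
    using X(2) X'(2) card_ge_0_finite[of X] card_ge_0_finite[of X'] by simp_all
  have "card (X - {x, y, z}) = card (X' - {x', y', z'})"
    using X X' by (simp add: card_Diff_subset)
  then obtain h0 where h0: "bij_betw h0 (X - {x, y, z}) (X' - {x', y', z'})"
    using fin finite_same_card_bij by (metis finite_Diff)
  define h where "h w = (if w = x then x' else if w = y then y' else if w = z then z' else h0 w)" for w
  have h: "h x = x'" "h y = y'" "h z = z'" "\<And>w. w \<in> X - {x, y, z} \<Longrightarrow> h w = h0 w"
    using X by (auto simp: h_def)
  have "bij_betw h (X - {x, y, z}) (X' - {x', y', z'})"
    using h0 h by (subst bij_betw_cong[of _ h h0]) auto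
  moreover have "bij_betw h {x, y, z} {x', y', z'}"
    using h X X' by (auto simp: bij_betw_def)
  ultimately have bij': "bij_betw h ((X - {x, y, z}) \<union> {x, y, z}) ((X' - {x', y', z'}) \<union> {x', y', z'})"
    by (rule bij_betw_combine) auto
  have X_eq: "(X - {x, y, z}) \<union> {x, y, z} = X" using X by blast
  have X'_eq: "(X' - {x', y', z'}) \<union> {x', y', z'} = X'" using X' by blast
  have "bij_betw h X X'" using bij' unfolding X_eq X'_eq .
  hence bij: "inj_on h X" "h ` X = X'" by (simp_all only: bij_betw_def)
  have "d (h ` X - {h z}) = d (X - {z})"
  proof (rule d_face_determined[OF X(1,2) bij(1) _ X(5)])
    show "h ` X \<subseteq> \<Omega>" using bij X' by simp
    fix w assume w: "w \<in> X" "w \<noteq> z"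
    show "d (h ` X - {h w}) = d (X - {w})"
    proof (cases "w = x \<or> w = y")
      case True
      thus ?thesis using bij h X X' by auto
    next
      case False
      hence "w \<in> X - {x, y, z}" using w by simp
      moreover from this have "h w \<in> X' - {x', y', z'}"
        using h h0 bij_betwE by metis
      ultimately show ?thesis using X(12) X'(12) bij by metis
    qed
  qed
  thus ?thesis using bij h X X' by simp
qed

text \<open>
  The \<open>k\<close>-subsets of the \<open>k + 2\<close> points \<open>x i\<close> of \<open>U\<close> are indexed by the pair \<open>i, j\<close> of omitted points; their
  colors reappear as \<^const>\<open>d\<close> on the faces through \<^term>\<open>None\<close>.
\<close>

lemma ex_configuration:
  assumes c: "\<And>i j. c i j \<in> {1..n}" and csym: "\<And>i j. c i j = c j i"
  shows "\<exists>x. inj_on x {..<k+2} \<and> x ` {..<k+2} \<subseteq> Some ` U \<and>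
    (\<forall>i<k+2. \<forall>j<k+2. i \<noteq> j \<longrightarrow> d (insert None (x ` {..<k+2} - {x i}) - {x j}) = c i j)"
proof -
  let ?V = "{..<k+2}"
  \<comment> \<open>On a \<open>k\<close>-subset the minimum and maximum of the complement are the
    two omitted points; their order is irrelevant because \<open>c\<close> is symmetric.\<close>
  define f where "f e = (let i = Min (?V - e); j = Max (?V - e) in c i j)" for e
  obtain h where h: "inj_on h ?V" "h ` ?V \<subseteq> U" "\<And>e. e \<subseteq> ?V \<Longrightarrow> card e = k \<Longrightarrow> col (h ` e) = f e"
    using universal[of ?V f] c by (auto simp: f_def Let_def)
  let ?x = "Some \<circ> h"
  have "d (insert None (?x ` ?V - {?x i}) - {?x j}) = c i j" if ij: "i < k+2" "j < k+2" "i \<noteq> j" for i j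
  proof -
    let ?e = "?V - {i, j}"
    have e: "?e \<subseteq> ?V" "card ?e = k"
      using ij by (auto simp: card_Diff_subset)
    have "?V - ?e = {i, j}" using ij by auto
    hence "f ?e = c i j"
      using csym by (auto simp: f_def Let_def min_def max_def)
    hence "col (h ` ?e) = c i j" using h(3)[OF e] by simp
    moreover have "insert None (?x ` ?V - {?x i}) - {?x j} = insert None (Some ` h ` ?e)"
      using h(1) ij by (auto simp: inj_on_def)
    moreover have "card (h ` ?e) = k"
      using e h(1) by (metis card_image inj_on_subset)
    ultimately show ?thesis
      using h(2) by (auto simp: d_insert_None image_subset_iff)
  qed
  thus ?thesis
    using h by (intro exI[of _ ?x]) (auto simp: inj_on_def)
qed

lemma card_configuration:
  assumes x: "inj_on x {..<k+2}" "x ` {..<k+2} \<subseteq> Some ` U" and i: "i < k+2"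
  shows "card (x ` {..<k+2}) = k + 2" "card (insert None (x ` {..<k+2} - {x i})) = k + 2"
proof -
  show 1: "card (x ` {..<k+2}) = k + 2" using x by (simp add: card_image)
  have "None \<notin> x ` {..<k+2}" using x by auto
  thus "card (insert None (x ` {..<k+2} - {x i})) = k + 2"
    using 1 i by (subst card_insert_disjoint) auto
qed

text \<open>Take \<open>k + 2\<close> points of \<open>U\<close> whose \<open>k\<close>-subsets all
  have color 1. Replacing any one of them by \<open>None\<close> gives a set whose faces through
  \<open>None\<close> all have color 1, so its last face has a color \<open>e\<close> independent of
  the point replaced. These last faces are all the faces of the original \<open>k + 2\<close>
  points.\<close>

lemma ex_unit:
  assumes "n \<ge> 1"
  shows "\<exists>e\<in>{1..n}. face_relation e e e e"
proof -
  let ?V = "{..<k+2}"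
  obtain x where x: "inj_on x ?V" "x ` ?V \<subseteq> Some ` U"
    and dx: "\<And>i j. i < k+2 \<Longrightarrow> j < k+2 \<Longrightarrow> i \<noteq> j \<Longrightarrow> d (insert None (x ` ?V - {x i}) - {x j}) = 1"
    using ex_configuration[of "\<lambda>_ _. 1"] assms by auto
  let ?X = "\<lambda>i. insert None (x ` ?V - {x i})"
  have None: "None \<notin> x ` ?V" using x by auto
  have face: "?X i - {None} = x ` ?V - {x i}" for i using None by auto
  define e where "e = d (x ` ?V - {x 0})"
  have eq: "d (x ` ?V - {x i}) = e" if "i < k+2" for i
  proof -
    \<comment> \<open>This transposition fixes \<open>None\<close> and carries \<open>?X 0\<close>
      to \<open>?X i\<close>, so the last faces of both sets can be compared.\<close>
    let ?h = "Transposition.transpose (x 0) (x i)"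
    have "?h ` (x ` ?V - {x 0}) = x ` ?V - {x i}"
      using that by (subst image_set_diff) auto
    moreover have "?h None = None"
      using None imageI[of 0 ?V x] imageI[of i ?V x] that
      by (intro transpose_apply_other) auto
    ultimately have hX: "?h ` ?X 0 = ?X i" by simp
    have "d (?h ` ?X 0 - {?h None}) = d (?X 0 - {None})"
    proof (rule d_face_determined)
      show "card (?X 0) = k + 2" using card_configuration[OF x, of 0] by simp
      show "?X 0 \<subseteq> \<Omega>" "?h ` ?X 0 \<subseteq> \<Omega>" unfolding hX using x by auto
      show "inj_on ?h (?X 0)" by (rule inj_on_subset[OF inj_transpose subset_UNIV])
      show "None \<in> ?X 0" by simp
      fix w assume w: "w \<in> ?X 0" "w \<noteq> None"
      then obtain j where j: "w = x j" "j < k+2" "j \<noteq> 0" by auto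
      have "?h w \<in> ?X i" using imageI[OF w(1), of ?h] unfolding hX .
      moreover have "?h w \<noteq> None" using w(2) inj_eq[OF inj_transpose, of "x 0" "x i" w None] \<open>?h None = None\<close> by simp
      ultimately obtain l where l: "?h w = x l" "l < k+2" "l \<noteq> i" by auto
      show "d (?h ` ?X 0 - {?h w}) = d (?X 0 - {w})"
        unfolding hX l(1) j(1) using dx[of i l] dx[of 0 j] l j that by simp
    qed
    thus ?thesis unfolding hX \<open>?h None = None\<close> face e_def .
  qed
  have ne: "x 0 \<noteq> x 1" "x 0 \<noteq> x 2" "x 1 \<noteq> x 2"
    using x(1) k_ge_2 by (auto simp: inj_on_eq_iff)
  have "face_relation e e e e"
    unfolding face_relation_def
    by (rule exI[of _ "x ` ?V"], rule exI[of _ "x 0"], rule exI[of _ "x 1"], rule exI[of _ "x 2"])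
      (use x eq ne k_ge_2 card_configuration(1)[OF x, of 0] in auto)
  moreover have "e \<in> {1..n}"
    unfolding e_def using x card_configuration(1)[OF x, of 0] by (intro d_range) auto
  ultimately show ?thesis by blast
qed

text \<open>Color the edges on \<open>k + 2\<close> points of \<open>U\<close> by \<open>a\<close>,
  \<open>b\<close>, \<open>c\<close> when the omitted pair is 01, 02, 12, and by \<open>e\<close>
  otherwise. Replacing the point 0, 1 or 2 by \<open>None\<close> exhibits \<open>a * b\<close>,
  \<open>a * c\<close> and \<open>b * c\<close> as colors of faces of the original points; the set
  of these points multiplies the first two to the third.\<close>

lemma face_relation_product:
  assumes e: "e \<in> {1..n}" "face_relation e e e e" and abc: "a \<in> {1..n}" "b \<in> {1..n}" "c \<in> {1..n}"
  shows "\<exists>p\<in>{1..n}. \<exists>q\<in>{1..n}. \<exists>r\<in>{1..n}. face_relation e a b p \<and> face_relation e a c q \<and>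
    face_relation e b c r \<and> face_relation e p q r"
proof -
  let ?V = "{..<k+2}"
  define f :: "nat \<Rightarrow> nat \<Rightarrow> nat" where "f i j = (if {i, j} = {0, 1} then a else if {i, j} = {0, 2} then b
    else if {i, j} = {1, 2} then c else e)" for i j
  have "f i j \<in> {1..n}" "f i j = f j i" for i j
    using e abc by (auto simp: f_def insert_commute)
  from ex_configuration[of f, OF this] obtain x where x: "inj_on x ?V" "x ` ?V \<subseteq> Some ` U"
    and dx: "\<And>i j. i < k+2 \<Longrightarrow> j < k+2 \<Longrightarrow> i \<noteq> j \<Longrightarrow> d (insert None (x ` ?V - {x i}) - {x j}) = f i j"
    by blast
  let ?d = "\<lambda>i. d (x ` ?V - {x i})"
  have None: "None \<notin> x ` ?V" using x by auto
  \<comment> \<open>\<open>None\<close> takes the place of \<open>x i\<close>. The face opposite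
    \<open>None\<close> has color \<open>?d i\<close>, which is thus the product of the colors
    opposite \<open>x j\<close> and \<open>x l\<close>.\<close>
  have rel: "face_relation e (f i j) (f i l) (?d i)"
    if ij: "i < k+2" "j < k+2" "l < k+2" "i \<noteq> j" "i \<noteq> l" "j \<noteq> l"
      and other: "\<And>m. m < k+2 \<Longrightarrow> m \<noteq> i \<Longrightarrow> m \<noteq> j \<Longrightarrow> m \<noteq> l \<Longrightarrow> f i m = e" for i j l
  proof -
    let ?X = "insert None (x ` ?V - {x i})"
    have "x i \<noteq> x j" "x i \<noteq> x l" "x j \<noteq> x l"
      using x(1) ij by (auto simp: inj_on_eq_iff)
    moreover have "?X - {None} = x ` ?V - {x i}" using None by auto
    moreover have "d (?X - {w}) = e" if "w \<in> ?X - {x j, x l, None}" for w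
    proof -
      obtain m where m: "w = x m" "m < k+2" "m \<noteq> i" "m \<noteq> j" "m \<noteq> l" using \<open>w \<in> _\<close> by auto
      thus ?thesis using dx[of i m] other ij by simp
    qed
    ultimately show ?thesis
      unfolding face_relation_def
      by (intro exI[of _ ?X] exI[of _ "x j"] exI[of _ "x l"] exI[of _ None])
        (use ij None x card_configuration(2)[OF x, of i] dx[of i j] dx[of i l] in \<open>auto simp: image_iff\<close>)
  qed
  have ab: "face_relation e a b (?d 0)"
    using rel[of 0 1 2] k_ge_2 by (simp add: f_def doubleton_eq_iff)
  have ac: "face_relation e a c (?d 1)"
    using rel[of 1 0 2] k_ge_2 by (simp add: f_def doubleton_eq_iff)
  have bc: "face_relation e b c (?d 2)"
    using rel[of 2 0 1] k_ge_2 by (simp add: f_def doubleton_eq_iff)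
  have dd: "face_relation e (?d 0) (?d 1) (?d 2)"
  proof -
    \<comment> \<open>All faces through \<open>None\<close> have color \<open>e\<close> here, and
      \<open>e * e = e\<close>.\<close>
    have "?d m = e" if "m < k+2" "m \<ge> 3" for m
    proof -
      have "face_relation e e e (?d m)"
        using rel[of m 0 1] that by (simp add: f_def doubleton_eq_iff)
      thus ?thesis using e face_relation_functional by blast
    qed
    moreover have "m \<ge> 3" if "x m \<notin> {x 0, x 1, x 2}" for m
      using that by (cases "m = 0"; cases "m = 1"; cases "m = 2") auto
    ultimately have "\<forall>w\<in>x ` ?V - {x 0, x 1, x 2}. d (x ` ?V - {w}) = e" by blast
    moreover have "x 0 \<noteq> x 1" "x 0 \<noteq> x 2" "x 1 \<noteq> x 2"
      using x(1) k_ge_2 by (auto simp: inj_on_eq_iff)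
    ultimately show ?thesis
      unfolding face_relation_def
      by (intro exI[of _ "x ` ?V"] exI[of _ "x 0"] exI[of _ "x 1"] exI[of _ "x 2"])
        (use x k_ge_2 card_configuration(1)[OF x, of 0] in auto)
  qed
  have "?d i \<in> {1..n}" if "i < k+2" for i
    using x that card_configuration(1)[OF x that] by (intro d_range) auto
  hence "?d 0 \<in> {1..n}" and "?d 1 \<in> {1..n}" and "?d 2 \<in> {1..n}"
    using k_ge_2 by simp_all
  with ab ac bc dd show ?thesis
    by (intro bexI[of _ "?d 0"] bexI[of _ "?d 1"] bexI[of _ "?d 2"] conjI)
qed

lemma power_of_two:
  assumes "n \<ge> 1"
  shows "\<exists>m. n = 2 ^ m"
proof -
  obtain e where e: "e \<in> {1..n}" "face_relation e e e e"
    using ex_unit[OF assms] by blast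
  have "\<exists>m. card {1..n} = 2 ^ m"
    by (rule card_power_of_two_if_boolean_relation[where T = "face_relation e",
          OF finite_atLeastAtMost e face_relation_sym1 face_relation_sym2 face_relation_functional
            face_relation_product[OF e]])
  thus ?thesis by simp
qed

end

section \<open>Coboundaries of binary colorings\<close>

text \<open>The default simp rule turns sums of bits into xor, which hides the additive group laws.\<close>

declare add_bit_eq_xor [simp del]

lemma bit_add_self [simp]: "a + a = 0" "a + (a + b) = b" for a b :: bit
  by (cases a; cases b; simp)+

text \<open>Modulo 2 the terms at \<open>(x, y)\<close> and \<open>(y, x)\<close> cancel.\<close>

lemma sum_off_diagonal_bit:
  fixes f :: "'b \<Rightarrow> 'b \<Rightarrow> bit"
  assumes "finite X" "\<And>x y. f x y = f y x"
  shows "(\<Sum>x\<in>X. \<Sum>y\<in>X - {x}. f x y) = 0"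
  using assms(1)
proof (induction X rule: finite_induct)
  case (insert a F)
  have "(\<Sum>x\<in>F. \<Sum>y\<in>insert a F - {x}. f x y) = (\<Sum>x\<in>F. f x a + (\<Sum>y\<in>F - {x}. f x y))"
  proof (rule sum.cong[OF refl])
    fix x assume "x \<in> F"
    hence "insert a F - {x} = insert a (F - {x})" using insert.hyps by auto
    thus "(\<Sum>y\<in>insert a F - {x}. f x y) = f x a + (\<Sum>y\<in>F - {x}. f x y)"
      using insert.hyps by simp
  qed
  also have "\<dots> = (\<Sum>x\<in>F. f a x)"
    using insert.IH assms(2)[of a] by (simp add: sum.distrib)
  finally show ?case
    using insert.hyps by simp
qed simp

text \<open>The simplicial coboundary modulo 2, hence without signs, on sets of every size at once.
  On infinite sets the sum is 0.\<close>

definition coboundary :: "('b set \<Rightarrow> bit) \<Rightarrow> 'b set \<Rightarrow> bit" where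
  "coboundary c S = (\<Sum>s\<in>S. c (S - {s}))"

text \<open>Removing two points in either order leaves the same set, so the terms cancel in
  pairs.\<close>

lemma coboundary_coboundary:
  assumes "finite X"
  shows "(\<Sum>x\<in>X. coboundary c (X - {x})) = 0"
  unfolding coboundary_def
proof (rule sum_off_diagonal_bit[OF assms])
  show "c (X - {x} - {y}) = c (X - {y} - {x})" for x y
    by (rule arg_cong[of _ _ c]) blast
qed

text \<open>Isolates the faces that omit \<open>x\<close> or \<open>y\<close>, so that prescribing
  the coboundary becomes an equation for \<open>c (insert y s)\<close>.\<close>

lemma coboundary_insert2:
  assumes "finite s" "x \<notin> s" "y \<notin> s" "x \<noteq> y"
  shows "coboundary c (insert x (insert y s)) =
    c (insert y s) + c (insert x s) + (\<Sum>t\<in>s. c (insert x (insert y (s - {t}))))"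
proof -
  have "insert x (insert y s) - {x} = insert y s" "insert x (insert y s) - {y} = insert x s"
    using assms by auto
  moreover have "insert x (insert y s) - {t} = insert x (insert y (s - {t}))" if "t \<in> s" for t
    using assms that by auto
  ultimately show ?thesis
    using assms by (simp add: coboundary_def add.assoc)
qed

text \<open>The vanishing of the double coboundary on \<open>insert x (insert y s)\<close>, solved
  for the one face without \<open>x\<close>: a coboundary is determined by its values on sets
  through \<open>x\<close>.\<close>

lemma coboundary_change_point:
  assumes "finite s" "x \<notin> s" "y \<notin> s" "x \<noteq> y"
  shows "coboundary c (insert y s) = coboundary c (insert x s) +
    (\<Sum>t\<in>s. coboundary c (insert x (insert y (s - {t}))))"
proof -
  let ?d = "coboundary c" and ?X = "insert x (insert y s)"
  have "?X - {x} = insert y s" "?X - {y} = insert x s"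
    using assms by auto
  moreover have "?X - {t} = insert x (insert y (s - {t}))" if "t \<in> s" for t
    using assms that by auto
  ultimately have "?d (insert y s) + (?d (insert x s) + (\<Sum>t\<in>s. ?d (insert x (insert y (s - {t}))))) = 0"
    using coboundary_coboundary[of ?X c] assms by simp
  thus ?thesis
    by (simp add: add_eq_0_iff2)
qed

text \<open>The limit of a chain of partial maps satisfying \<open>P\<close>. The conclusion places
  any finite set of points inside a single stage, since the properties to be transferred concern
  finitely many points at a time.\<close>

lemma back_and_forth:
  fixes P :: "'b set \<Rightarrow> ('b \<Rightarrow> 'c) \<Rightarrow> bool"
  assumes X: "countable X" "X \<noteq> {}" and Y: "countable Y" "Y \<noteq> {}" and init: "P A0 h0"
    and forth_step: "\<And>A h x. P A h \<Longrightarrow> x \<in> X \<Longrightarrow>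
      \<exists>A' h'. P A' h' \<and> A \<subseteq> A' \<and> (\<forall>a\<in>A. h' a = h a) \<and> x \<in> A'"
    and back_step: "\<And>A h y. P A h \<Longrightarrow> y \<in> Y \<Longrightarrow>
      \<exists>A' h'. P A' h' \<and> A \<subseteq> A' \<and> (\<forall>a\<in>A. h' a = h a) \<and> y \<in> h' ` A'"
  shows "\<exists>g. (\<forall>F. finite F \<longrightarrow> F \<subseteq> X \<longrightarrow> (\<exists>A h. P A h \<and> F \<subseteq> A \<and> (\<forall>a\<in>A. g a = h a))) \<and>
    (\<forall>y\<in>Y. \<exists>A h. P A h \<and> y \<in> h ` A \<and> (\<forall>a\<in>A. g a = h a))"
proof -
  define ext where "ext p q \<longleftrightarrow> fst p \<subseteq> fst q \<and> (\<forall>a\<in>fst p. snd q a = snd p a)"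
    for p q :: "'b set \<times> ('b \<Rightarrow> 'c)"
  \<comment> \<open>Each stage performs one forth step for the \<open>i\<close>-th point of
    \<open>X\<close> and then one back step for the \<open>i\<close>-th point of
    \<open>Y\<close>.\<close>
  have "\<exists>f. \<forall>i. P (fst (f i)) (snd (f i)) \<and> (ext (f i) (f (Suc i)) \<and>
      from_nat_into X i \<in> fst (f (Suc i)) \<and> from_nat_into Y i \<in> snd (f (Suc i)) ` fst (f (Suc i)))"
  proof (rule dependent_nat_choice)
    show "\<exists>p. P (fst p) (snd p)" using init by auto
    fix p i assume p: "P (fst p) (snd p)"
    obtain A h where 1: "P A h" "fst p \<subseteq> A" "\<forall>a\<in>fst p. h a = snd p a" "from_nat_into X i \<in> A"
      using forth_step[OF p from_nat_into[OF X(2), of i]] by blast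
    then obtain A' h' where 2: "P A' h'" "A \<subseteq> A'" "\<forall>a\<in>A. h' a = h a" "from_nat_into Y i \<in> h' ` A'"
      using back_step[OF 1(1) from_nat_into[OF Y(2), of i]] by blast
    have "ext p (A', h')"
      unfolding ext_def using 1(2,3) 2(2,3) by auto
    moreover have "from_nat_into X i \<in> A'" using 1(4) 2(2) by blast
    ultimately show "\<exists>q. P (fst q) (snd q) \<and> (ext p q \<and> from_nat_into X i \<in> fst q \<and>
        from_nat_into Y i \<in> snd q ` fst q)"
      using 2 by (intro exI[of _ "(A', h')"]) simp
  qed
  then obtain f where f: "\<And>i. P (fst (f i)) (snd (f i))" "\<And>i. ext (f i) (f (Suc i))"
      "\<And>i. from_nat_into X i \<in> fst (f (Suc i))" "\<And>i. from_nat_into Y i \<in> snd (f (Suc i)) ` fst (f (Suc i))"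
    by blast
  define A where "A i = fst (f i)" for i
  define h where "h i = snd (f i)" for i
  have mono: "A i \<subseteq> A j \<and> (\<forall>a\<in>A i. h j a = h i a)" if "i \<le> j" for i j
    using that
  proof (induction j rule: dec_induct)
    case (step j)
    thus ?case using f(2)[of j] unfolding ext_def A_def h_def by auto
  qed simp
  \<comment> \<open>The first stage containing \<open>a\<close> decides its image; by
    \<open>mono\<close> all later stages agree with it.\<close>
  define g where "g a = h (LEAST i. a \<in> A i) a" for a
  have g: "g a = h i a" if "a \<in> A i" for a i
  proof -
    have "a \<in> A (LEAST i. a \<in> A i)" "(LEAST i. a \<in> A i) \<le> i"
      using that by (rule LeastI, rule Least_le)
    thus ?thesis unfolding g_def using mono by metis
  qed
  have fin: "\<exists>i. F \<subseteq> A i" if "finite F" "F \<subseteq> X" for F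
    using that
  proof (induction F rule: finite_induct)
    case (insert x F)
    then obtain i where i: "F \<subseteq> A i" by blast
    have "from_nat_into X (to_nat_on X x) = x"
      using insert.prems X by (intro from_nat_into_to_nat_on) auto
    with f(3)[of "to_nat_on X x"] have "x \<in> A (Suc (to_nat_on X x))"
      by (simp add: A_def)
    hence "insert x F \<subseteq> A (max i (Suc (to_nat_on X x)))"
      using i mono[OF max.cobounded1, of i "Suc (to_nat_on X x)"]
        mono[OF max.cobounded2, of "Suc (to_nat_on X x)" i] by blast
    thus ?case by blast
  qed simp
  show ?thesis
  proof (intro exI[of _ g] conjI allI impI ballI)
    show "\<exists>A h. P A h \<and> F \<subseteq> A \<and> (\<forall>a\<in>A. g a = h a)" if F: "finite F" "F \<subseteq> X" for F
    proof -
      obtain i where "F \<subseteq> A i" using fin[OF F] by blast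
      thus ?thesis using f(1)[of i] g by (intro exI[of _ "A i"] exI[of _ "h i"]) (simp add: A_def h_def)
    qed
    show "\<exists>A h. P A h \<and> y \<in> h ` A \<and> (\<forall>a\<in>A. g a = h a)" if y: "y \<in> Y" for y
    proof -
      let ?i = "Suc (to_nat_on Y y)"
      have "from_nat_into Y (to_nat_on Y y) = y"
        using y Y by (intro from_nat_into_to_nat_on) auto
      hence "y \<in> h ?i ` A ?i"
        using f(4)[of "to_nat_on Y y"] by (simp add: A_def h_def)
      thus ?thesis using f(1)[of ?i] g by (intro exI[of _ "A ?i"] exI[of _ "h ?i"]) (simp add: A_def h_def)
    qed
  qed
qed

text \<open>The one-point extension property. Universality realizes an abstract copy of
  \<open>A\<close> together with the new point, and homogeneity moves the copy of \<open>A\<close>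
  back onto \<open>A\<close>.\<close>

lemma (in generic_coloring) ex_point_with_link:
  assumes A: "finite A" "A \<subseteq> U" and f: "\<And>s. s \<subseteq> A \<Longrightarrow> card s = k - 1 \<Longrightarrow> f s \<in> {1..n}"
  shows "\<exists>y\<in>U - A. \<forall>s\<subseteq>A. card s = k - 1 \<longrightarrow> col (insert y s) = f s"
proof -
  let ?N = "card A"
  obtain b where b: "inj_on b {..<?N}" "b ` {..<?N} = A"
    using ex_bij_betw_nat_finite[OF A(1)] by (auto simp: bij_betw_def atLeast0LessThan)
  \<comment> \<open>The number \<open>?N\<close> stands for the new point: edges through it are
    colored by \<open>f\<close>, the others as in \<open>A\<close>.\<close>
  define c where "c e = (if ?N \<in> e then f (b ` (e - {?N})) else col (b ` e))" for e
  have bsub: "b ` e \<subseteq> A" "card (b ` e) = card e" if "e \<subseteq> {..<?N}" for e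
    using that b by (auto intro: card_image inj_on_subset)
  have "c e \<in> {1..n}" if e: "e \<subseteq> {..?N}" "card e = k" for e
  proof (cases "?N \<in> e")
    case True
    hence "e - {?N} \<subseteq> {..<?N}" "card (e - {?N}) = k - 1"
      using e by (auto simp: order_le_less)
    thus ?thesis using bsub[of "e - {?N}"] f True by (simp add: c_def)
  next
    case False
    hence "e \<subseteq> {..<?N}" using e by (auto simp: order_le_less)
    thus ?thesis using bsub[of e] col_range[of "b ` e"] A e False by (simp add: c_def)
  qed
  then obtain h where h: "inj_on h {..?N}" "h ` {..?N} \<subseteq> U"
    "\<And>e. e \<subseteq> {..?N} \<Longrightarrow> card e = k \<Longrightarrow> col (h ` e) = c e"
    using universal[of "{..?N}" c] by auto
  have h': "inj_on h {..<?N}"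
    using h(1) by (rule inj_on_subset) auto
  \<comment> \<open>\<open>\<phi>\<close> sends the copy of \<open>A\<close> back to
    \<open>A\<close> and preserves colors.\<close>
  define \<phi> where "\<phi> w = b (the_inv_into {..<?N} h w)" for w
  have \<phi>: "\<phi> (h i) = b i" if "i < ?N" for i
    using the_inv_into_f_f[OF h'] that by (simp add: \<phi>_def)
  have \<phi>_image: "\<phi> ` h ` s = b ` s" if "s \<subseteq> {..<?N}" for s
    unfolding image_image using that \<phi> by (intro image_cong) auto
  have "\<exists>g. g permutes U \<and> (\<forall>e\<subseteq>U. card e = k \<longrightarrow> col (g ` e) = col e) \<and> (\<forall>x\<in>h ` {..<?N}. g x = \<phi> x)"
  proof (rule homogeneous)
    show "h ` {..<?N} \<subseteq> U" using h by auto
    show "inj_on \<phi> (h ` {..<?N})"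
      using \<phi> b by (auto simp: inj_on_def)
    show "\<phi> ` h ` {..<?N} \<subseteq> U"
      using \<phi>_image[of "{..<?N}"] b A by simp
    fix e assume e: "e \<subseteq> h ` {..<?N}" "card e = k"
    then obtain s where s: "s \<subseteq> {..<?N}" "e = h ` s"
      by (meson subset_imageE)
    have "card s = k"
      using card_image[of h s] inj_on_subset[OF h' s(1)] e s by simp
    moreover have "?N \<notin> s" "s \<subseteq> {..?N}" using s by auto
    ultimately have "col e = col (b ` s)"
      using h(3)[of s] s by (simp add: c_def)
    thus "col (\<phi> ` e) = col e" using \<phi>_image[OF s(1)] s by simp
  qed simp
  then obtain g where g: "g permutes U" "\<And>e. e \<subseteq> U \<Longrightarrow> card e = k \<Longrightarrow> col (g ` e) = col e"
    "\<And>i. i < ?N \<Longrightarrow> g (h i) = b i"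
    using \<phi> by auto
  let ?y = "g (h ?N)"
  have "?y \<in> U"
    using h(2) permutes_in_image[OF g(1), of "h ?N"] by auto
  moreover have "?y \<notin> A"
  proof
    assume "?y \<in> A"
    hence "?y \<in> b ` {..<?N}" using b by simp
    then obtain i where i: "i < ?N" "?y = b i" by blast
    hence "g (h i) = ?y" using g(3) by simp
    hence "h i = h ?N" using permutes_inj[OF g(1)] by (simp add: inj_eq)
    thus False using h(1) i(1) inj_on_eq_iff[of h "{..?N}" i ?N] by simp
  qed
  moreover have "col (insert ?y s) = f s" if s: "s \<subseteq> A" "card s = k - 1" for s
  proof -
    obtain t where t: "t \<subseteq> {..<?N}" "s = b ` t"
      using s b by (metis subset_imageE)
    have ct: "card t = k - 1" "finite t" "?N \<notin> t"
      using bsub(2)[OF t(1)] s t finite_subset[OF t(1)] by auto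
    have "g ` h ` t = s"
      unfolding t(2) image_image using t g(3) by (intro image_cong) auto
    hence "insert ?y s = g ` h ` insert ?N t" by simp
    moreover have "card (insert ?N t) = k"
      using ct k_ge_2 by simp
    moreover have "insert ?N t \<subseteq> {..?N}" using t by auto
    moreover have "card (h ` insert ?N t) = card (insert ?N t)"
      by (rule card_image, rule inj_on_subset[OF h(1)]) (use t in auto)
    moreover have "h ` insert ?N t \<subseteq> U" using h(2) \<open>insert ?N t \<subseteq> {..?N}\<close> by blast
    ultimately have "col (insert ?y s) = c (insert ?N t)"
      using g(2)[of "h ` insert ?N t"] h(3)[of "insert ?N t"] by simp
    also have "\<dots> = f s" using ct t by (simp add: c_def)
    finally show ?thesis .
  qed
  ultimately show ?thesis by blast
qed

text \<open>The bit vector of the color \<open>i\<close> is the characteristic function of \<open>\<beta> i\<close>.\<close>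

locale binary_coloring = generic_coloring U k n col
  for U :: "'a set" and k n col +
  fixes m :: nat and \<beta> :: "nat \<Rightarrow> nat set"
  assumes bij_\<beta>: "bij_betw \<beta> {1..n} (Pow {..<m})"
begin

section \<open>Bits of the coloring and extension properties of their coboundaries\<close>

abbreviation \<Omega> :: "'a option set" where "\<Omega> \<equiv> insert None (Some ` U)"

text \<open>One coordinate of the vector-valued coloring, extended by zero to the sets through
  \<open>None\<close>.\<close>

definition color_bit :: "nat \<Rightarrow> 'a option set \<Rightarrow> bit" where
  "color_bit j e = (if None \<in> e then 0 else of_bool (j \<in> \<beta> (col (Option.these e))))"

abbreviation \<delta> :: "nat \<Rightarrow> 'a option set \<Rightarrow> bit" where "\<delta> j \<equiv> coboundary (color_bit j)"

lemma color_bit_Some: "color_bit j (Some ` e) = of_bool (j \<in> \<beta> (col e))"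
  by (auto simp: color_bit_def)

text \<open>Surjectivity of \<open>\<beta>\<close>: as there are \<open>2 ^ m\<close> colors, every
  bit vector is a color.\<close>

lemma ex_color_of_bits: "\<exists>i\<in>{1..n}. \<forall>j<m. of_bool (j \<in> \<beta> i) = (v j :: bit)"
proof -
  have "{j. j < m \<and> v j = 1} \<in> \<beta> ` {1..n}"
    using bij_\<beta> by (auto simp: bij_betw_def)
  then obtain i where "i \<in> {1..n}" "\<beta> i = {j. j < m \<and> v j = 1}"
    by (metis (no_types, lifting) imageE)
  thus ?thesis by (intro bexI[of _ i]) auto
qed

text \<open>The extension property in terms of bits. Nothing is prescribed on sets through
  \<open>None\<close>, where the bits are zero by definition.\<close>

lemma ex_point_with_bits:
  assumes B: "finite B" "B \<subseteq> \<Omega>"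
  shows "\<exists>y\<in>Some ` U - B. \<forall>s\<subseteq>B - {None}. card s = k - 1 \<longrightarrow>
    (\<forall>j<m. color_bit j (insert y s) = w j s)"
proof -
  let ?A = "Option.these B"
  have B': "B - {None} = Some ` ?A" by (auto simp: Some_image_these_eq)
  have A: "finite ?A" "?A \<subseteq> U"
  proof -
    have "finite (Some ` ?A)" using B unfolding B'[symmetric] by simp
    thus "finite ?A" by (simp add: finite_image_iff)
    show "?A \<subseteq> U" using B(2) by (auto simp: in_these_eq)
  qed
  define f where "f s = (SOME i. i \<in> {1..n} \<and> (\<forall>j<m. of_bool (j \<in> \<beta> i) = w j (Some ` s)))" for s
  have f: "f s \<in> {1..n}" "\<And>j. j < m \<Longrightarrow> of_bool (j \<in> \<beta> (f s)) = w j (Some ` s)" for s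
    using someI_ex[of "\<lambda>i. i \<in> {1..n} \<and> (\<forall>j<m. of_bool (j \<in> \<beta> i) = w j (Some ` s))"]
      ex_color_of_bits[of "\<lambda>j. w j (Some ` s)"]
    unfolding f_def by blast+
  obtain y where y: "y \<in> U - ?A" "\<forall>s\<subseteq>?A. card s = k - 1 \<longrightarrow> col (insert y s) = f s"
    using ex_point_with_link[OF A f(1)] by (rule bexE)
  have "color_bit j (insert (Some y) s) = w j s"
    if s: "s \<subseteq> B - {None}" "card s = k - 1" and j: "j < m" for s j
  proof -
    obtain t where t: "t \<subseteq> ?A" "s = Some ` t"
      using s(1) unfolding B' by (meson subset_imageE)
    hence "card t = k - 1" using s(2) by (simp add: card_image)
    hence "col (insert y t) = f t" using y(2) t(1) by blast
    thus ?thesis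
      using f(2)[OF j, of t] t(2) color_bit_Some[of j "insert y t"] by simp
  qed
  moreover have "Some y \<in> Some ` U - B"
    using y(1) by (auto simp: in_these_eq)
  ultimately show ?thesis by blast
qed

text \<open>The coloring that the coboundary induces around any point \<open>x\<close>, not only
  around \<open>None\<close>, has the extension property. The wanted values of
  \<open>\<delta>\<close> are converted into bits at the new point by solving the coboundary
  equation.\<close>

lemma ex_point_with_coboundary:
  assumes B: "finite B" "B \<subseteq> \<Omega>" and x: "x \<in> B"
  shows "\<exists>y\<in>\<Omega> - B. \<forall>s\<subseteq>B - {x}. card s = k - 1 \<longrightarrow> (\<forall>j<m. \<delta> j (insert x (insert y s)) = v j s)"
proof -
  \<comment> \<open>For \<open>x = None\<close> the bit is the wanted value itself. Otherwise the
    bits on edges through both \<open>x\<close> and \<open>y\<close> are fixed by the sets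
    \<open>s\<close> containing \<open>None\<close>; the bits on edges through \<open>y\<close> but
    not \<open>x\<close> then follow from the equation for \<open>s\<close>.\<close>
  define w where "w j s = (if x = None then v j s
    else if x \<in> s then v j (insert None (s - {x}))
    else v j s + color_bit j (insert x s) + (\<Sum>t\<in>s. v j (insert None (s - {t}))))" for j s
  obtain y where y: "y \<in> Some ` U - B" and "\<forall>s\<subseteq>B - {None}. card s = k - 1 \<longrightarrow>
      (\<forall>j<m. color_bit j (insert y s) = w j s)"
    using ex_point_with_bits[OF B, of w] by (rule bexE)
  hence bits: "color_bit j (insert y s) = w j s" if "s \<subseteq> B - {None}" "card s = k - 1" "j < m" for s j
    using that by blast
  have None: "color_bit j e = 0" if "None \<in> e" for j e
    using that by (simp add: color_bit_def)
  have "\<delta> j (insert x (insert y s)) = v j s"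
    if s: "s \<subseteq> B - {x}" "card s = k - 1" and j: "j < m" for s j
  proof -
    have fin: "finite s" using s B finite_subset by blast
    have "x \<notin> s" "y \<notin> s" "x \<noteq> y" using s y x by auto
    note expand = coboundary_insert2[OF fin this, of "color_bit j"]
    show ?thesis
    proof (cases "x = None")
      case True
      have "color_bit j (insert y s) = w j s"
        using s j True by (intro bits) auto
      thus ?thesis unfolding expand using True by (simp add: None w_def)
    next
      case xN: False
      have swap: "color_bit j (insert x (insert y r)) = v j (insert None r)"
        if r: "insert x r \<subseteq> B - {None}" "x \<notin> r" "card (insert x r) = k - 1" for r
      proof -
        have "color_bit j (insert y (insert x r)) = w j (insert x r)"
          using r j by (intro bits) auto
        also have "\<dots> = v j (insert None r)" using r xN by (simp add: w_def)
        finally show ?thesis by (simp add: insert_commute)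
      qed
      have card_exchange: "card (insert x (s - {t})) = k - 1" if "t \<in> s" for t
        using that s fin \<open>x \<notin> s\<close> card_Suc_Diff1[OF fin that] by simp
      show ?thesis
      proof (cases "None \<in> s")
        case True
        \<comment> \<open>Every face containing \<open>None\<close> contributes zero, so only the
          face that omits \<open>None\<close> survives.\<close>
        have "(\<Sum>t\<in>s. color_bit j (insert x (insert y (s - {t})))) =
            color_bit j (insert x (insert y (s - {None})))
            + (\<Sum>t\<in>s - {None}. color_bit j (insert x (insert y (s - {t}))))"
          using fin True by (rule sum.remove)
        also have "(\<Sum>t\<in>s - {None}. color_bit j (insert x (insert y (s - {t})))) = 0"
          using True by (intro sum.neutral) (auto intro: None)
        also have "color_bit j (insert x (insert y (s - {None}))) = v j (insert None (s - {None}))"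
          using s x xN \<open>x \<notin> s\<close> card_exchange[OF True] by (intro swap) auto
        also have "insert None (s - {None}) = s" using True by auto
        finally show ?thesis unfolding expand using True by (simp add: None)
      next
        case False
        have "(\<Sum>t\<in>s. color_bit j (insert x (insert y (s - {t})))) = (\<Sum>t\<in>s. v j (insert None (s - {t})))"
          using s x xN \<open>x \<notin> s\<close> False card_exchange by (intro sum.cong swap) auto
        moreover have "color_bit j (insert y s) = w j s"
          using s j False by (intro bits) auto
        ultimately show ?thesis
          unfolding expand using xN \<open>x \<notin> s\<close> by (simp add: w_def)
      qed
    qed
  qed
  thus ?thesis using y by (intro bexI[of _ y]) auto
qed

section \<open>Finite partial isomorphisms of the coboundary\<close>

lemma the_inv_into_image_image:
  assumes "inj_on h A" "S \<subseteq> A"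
  shows "the_inv_into A h ` h ` S = S"
proof -
  have "(\<lambda>x. the_inv_into A h (h x)) ` S = (\<lambda>x. x) ` S"
    using assms by (intro image_cong refl the_inv_into_f_f) auto
  thus ?thesis by (simp add: image_image)
qed

definition partial_iso :: "'a option set \<Rightarrow> ('a option \<Rightarrow> 'a option) \<Rightarrow> bool" where
  "partial_iso A h \<longleftrightarrow> finite A \<and> A \<subseteq> \<Omega> \<and> inj_on h A \<and> h ` A \<subseteq> \<Omega> \<and>
     (\<forall>S\<subseteq>A. card S = Suc k \<longrightarrow> (\<forall>j<m. \<delta> j (h ` S) = \<delta> j S))"

lemma partial_iso_inverse:
  assumes "partial_iso A h"
  shows "partial_iso (h ` A) (the_inv_into A h)"
proof -
  have A: "finite A" "A \<subseteq> \<Omega>" "inj_on h A" "h ` A \<subseteq> \<Omega>"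
    "\<And>S j. S \<subseteq> A \<Longrightarrow> card S = Suc k \<Longrightarrow> j < m \<Longrightarrow> \<delta> j (h ` S) = \<delta> j S"
    using assms by (simp_all add: partial_iso_def)
  note inv = the_inv_into_image_image[OF A(3)]
  have "\<delta> j (the_inv_into A h ` S) = \<delta> j S" if S: "S \<subseteq> h ` A" "card S = Suc k" "j < m" for S j
  proof -
    obtain T where T: "T \<subseteq> A" "S = h ` T" using S(1) by (meson subset_imageE)
    hence "card T = Suc k" using S(2) card_image[OF inj_on_subset[OF A(3) T(1)]] by simp
    thus ?thesis using A(5)[OF T(1) _ S(3)] inv T by simp
  qed
  thus ?thesis
    unfolding partial_iso_def using A inv[OF subset_refl] inj_on_the_inv_into[OF A(3)] by simp
qed

text \<open>The point \<open>a\<close> serves as base point: the image of \<open>z\<close> is chosen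
  to be correct on the sets through \<open>a\<close> and \<open>z\<close>, and
  \<open>coboundary_change_point\<close> handles the sets through \<open>z\<close> that avoid
  \<open>a\<close>.\<close>

lemma partial_iso_forth:
  assumes h: "partial_iso A h" and a: "a \<in> A" and z: "z \<in> \<Omega>"
  shows "\<exists>h'. partial_iso (insert z A) h' \<and> (\<forall>x\<in>A. h' x = h x)"
proof (cases "z \<in> A")
  case True
  thus ?thesis using h by (intro exI[of _ h]) (simp add: insert_absorb)
next
  case z_notin: False
  have A: "finite A" "A \<subseteq> \<Omega>" "inj_on h A" "h ` A \<subseteq> \<Omega>"
    "\<And>S j. S \<subseteq> A \<Longrightarrow> card S = Suc k \<Longrightarrow> j < m \<Longrightarrow> \<delta> j (h ` S) = \<delta> j S"
    using h by (simp_all add: partial_iso_def)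
  note inv = the_inv_into_image_image[OF A(3)]
  \<comment> \<open>The values needed around \<open>h a\<close>, pulled back along the inverse of
    \<open>h\<close>.\<close>
  define v where "v j s = \<delta> j (insert a (insert z (the_inv_into A h ` s)))" for j s
  obtain y where y: "y \<in> \<Omega> - h ` A" "\<forall>s\<subseteq>h ` A - {h a}. card s = k - 1 \<longrightarrow>
      (\<forall>j<m. \<delta> j (insert (h a) (insert y s)) = v j s)"
    using ex_point_with_coboundary[OF finite_imageI[OF A(1)] A(4) imageI[OF a], of v] by (rule bexE)
  define h' where "h' = h(z := y)"
  have h'_eq: "h' x = h x" if "x \<in> A" for x
    using that z_notin by (auto simp: h'_def)
  have h'_image: "h' ` S = h ` S" if "S \<subseteq> A" for S
    using that h'_eq by (intro image_cong) auto
  have h'z: "h' z = y" by (simp add: h'_def)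
  have link: "\<delta> j (insert (h a) (insert y (h ` s))) = \<delta> j (insert a (insert z s))"
    if s: "s \<subseteq> A - {a}" "card s = k - 1" "j < m" for s j
  proof -
    have "h ` s \<subseteq> h ` A - {h a}"
      using s(1) a inj_on_eq_iff[OF A(3)] by auto
    moreover have "card (h ` s) = k - 1"
      using s card_image[OF inj_on_subset[OF A(3)], of s] by auto
    moreover have "s \<subseteq> A" using s(1) by blast
    ultimately show ?thesis using y(2) s(3) inv[of s] unfolding v_def by simp
  qed
  have "\<delta> j (h' ` S) = \<delta> j S" if S: "S \<subseteq> insert z A" "card S = Suc k" and j: "j < m" for S j
  proof (cases "z \<in> S")
    case False
    hence "S \<subseteq> A" using S(1) by blast
    thus ?thesis using A(5) S(2) j h'_image by simp
  next
    case True
    define s where "s = S - {z}"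
    have finS: "finite S" using S(2) card_ge_0_finite[of S] by simp
    have s: "s \<subseteq> A" "card s = k" "finite s" "S = insert z s" "z \<notin> s"
      using S True finS unfolding s_def by auto
    have h'S: "h' ` S = insert y (h ` s)"
      using s(4) h'z h'_image[OF s(1)] by simp
    show ?thesis
    proof (cases "a \<in> s")
      case True
      define r where "r = s - {a}"
      have r: "r \<subseteq> A - {a}" "card r = k - 1" "s = insert a r"
        using s True unfolding r_def by auto
      show ?thesis
        unfolding h'S using link[OF r(1,2) j] s(4) r(3) by (simp add: insert_commute)
    next
      case False
      have ha: "h a \<notin> h ` s" using False s(1) a inj_on_eq_iff[OF A(3)] by blast
      have "y \<notin> h ` s" "y \<noteq> h a" using y(1) s(1) a by auto
      \<comment> \<open>Both sides are rewritten as sums over sets through the base point, where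
        agreement comes from \<open>link\<close> and from \<open>h\<close>.\<close>
      note c = coboundary_change_point[OF finite_imageI[OF s(3)] ha this(1) this(2)[symmetric], of "color_bit j"]
      have "\<delta> j (insert y (h ` s)) = \<delta> j (insert (h a) (h ` s)) +
          (\<Sum>t\<in>h ` s. \<delta> j (insert (h a) (insert y (h ` s - {t}))))"
        by (rule c)
      also have "(\<Sum>t\<in>h ` s. \<delta> j (insert (h a) (insert y (h ` s - {t})))) =
          (\<Sum>t\<in>s. \<delta> j (insert (h a) (insert y (h ` s - {h t}))))"
        using inj_on_subset[OF A(3) s(1)] by (simp add: sum.reindex)
      also have "\<dots> = (\<Sum>t\<in>s. \<delta> j (insert a (insert z (s - {t}))))"
      proof (rule sum.cong[OF refl])
        fix t assume t: "t \<in> s"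
        have "h ` s - {h t} = h ` (s - {t})"
          using t s(1) inj_on_eq_iff[OF A(3)] by auto
        moreover have "s - {t} \<subseteq> A - {a}" using s(1) False by auto
        moreover have "card (s - {t}) = k - 1" using s t by simp
        ultimately show "\<delta> j (insert (h a) (insert y (h ` s - {h t}))) = \<delta> j (insert a (insert z (s - {t})))"
          using link j by simp
      qed
      also have "\<delta> j (insert (h a) (h ` s)) = \<delta> j (insert a s)"
        using A(5)[of "insert a s" j] s a False j by simp
      also have "\<delta> j (insert a s) + (\<Sum>t\<in>s. \<delta> j (insert a (insert z (s - {t})))) = \<delta> j (insert z s)"
        using a z_notin by (intro coboundary_change_point[symmetric] s False) auto
      finally show ?thesis by (simp only: h'S s(4)[symmetric])
    qed
  qed
  moreover have "inj_on h' (insert z A)"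
  proof -
    have "inj_on h' A" using A(3) h'_eq by (simp add: inj_on_def)
    moreover have "y \<notin> h' ` A" using y(1) h'_image[OF subset_refl] by simp
    ultimately show ?thesis using z_notin h'z by simp
  qed
  moreover have "h' ` insert z A \<subseteq> \<Omega>"
    using y(1) A(4) h'_image[OF subset_refl] h'z by simp
  ultimately have "partial_iso (insert z A) h'"
    unfolding partial_iso_def using A(1,2) z by simp
  thus ?thesis using h'_eq by blast
qed

text \<open>The forth step for the inverse map, inverted again.\<close>

lemma partial_iso_back:
  assumes h: "partial_iso A h" and a: "a \<in> A" and y: "y \<in> \<Omega>"
  shows "\<exists>A' h'. partial_iso A' h' \<and> A \<subseteq> A' \<and> (\<forall>x\<in>A. h' x = h x) \<and> y \<in> h' ` A'"
proof -
  have inj: "inj_on h A" using h by (simp add: partial_iso_def)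
  obtain f where f: "partial_iso (insert y (h ` A)) f" "\<And>x. x \<in> h ` A \<Longrightarrow> f x = the_inv_into A h x"
    using partial_iso_forth[OF partial_iso_inverse[OF h] imageI[OF a] y] by blast
  let ?B = "insert y (h ` A)"
  have injf: "inj_on f ?B" using f(1) by (simp add: partial_iso_def)
  have fh: "f (h x) = x" if "x \<in> A" for x
    using f(2) that the_inv_into_f_f[OF inj] by simp
  have "partial_iso (f ` ?B) (the_inv_into ?B f)"
    using f(1) by (rule partial_iso_inverse)
  moreover have "A \<subseteq> f ` ?B" using fh by force
  moreover have "the_inv_into ?B f x = h x" if "x \<in> A" for x
    using the_inv_into_f_f[OF injf, of "h x"] fh that by simp
  moreover have "y \<in> the_inv_into ?B f ` f ` ?B"
    using the_inv_into_f_f[OF injf, of y] by force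
  ultimately show ?thesis by blast
qed

section \<open>The automorphism group of the coboundary\<close>

definition cocycle_auts :: "('a option \<Rightarrow> 'a option) set" where
  "cocycle_auts = {g. g permutes \<Omega> \<and> (\<forall>S\<subseteq>\<Omega>. card S = Suc k \<longrightarrow> (\<forall>j<m. \<delta> j (g ` S) = \<delta> j S))}"

text \<open>Back-and-forth from the map sending \<open>x\<close> to \<open>y\<close>, a partial
  isomorphism because a single point has no subset of size \<open>k + 1\<close>.\<close>

lemma cocycle_auts_transitive:
  assumes x: "x \<in> \<Omega>" and y: "y \<in> \<Omega>"
  shows "\<exists>g\<in>cocycle_auts. g x = y"
proof -
  \<comment> \<open>Keeping \<open>x\<close> in the domain supplies the base point for both steps
    and ensures that the limit sends \<open>x\<close> to \<open>y\<close>.\<close>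
  let ?P = "\<lambda>A h. partial_iso A h \<and> x \<in> A \<and> h x = y"
  have "countable \<Omega>" using countable_U by simp
  have init: "?P {x} (\<lambda>_. y)"
  proof -
    have "card S \<noteq> Suc k" if "S \<subseteq> {x}" for S
      using card_mono[OF _ that] k_ge_2 by simp
    thus ?thesis using x y by (simp add: partial_iso_def)
  qed
  have forth_step: "\<exists>A' h'. ?P A' h' \<and> A \<subseteq> A' \<and> (\<forall>a\<in>A. h' a = h a) \<and> z \<in> A'"
    if "?P A h" "z \<in> \<Omega>" for A h z
  proof -
    obtain h' where "partial_iso (insert z A) h'" "\<forall>x\<in>A. h' x = h x"
      using partial_iso_forth[of A h x z] \<open>?P A h\<close> \<open>z \<in> \<Omega>\<close> by blast
    thus ?thesis using \<open>?P A h\<close> by (intro exI[of _ "insert z A"] exI[of _ h']) auto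
  qed
  have back_step: "\<exists>A' h'. ?P A' h' \<and> A \<subseteq> A' \<and> (\<forall>a\<in>A. h' a = h a) \<and> z \<in> h' ` A'"
    if "?P A h" "z \<in> \<Omega>" for A h z
  proof -
    obtain A' h' where "partial_iso A' h'" "A \<subseteq> A'" "\<forall>x\<in>A. h' x = h x" "z \<in> h' ` A'"
      using partial_iso_back[of A h x z] \<open>?P A h\<close> \<open>z \<in> \<Omega>\<close> by blast
    thus ?thesis using \<open>?P A h\<close> by (intro exI[of _ A'] exI[of _ h']) auto
  qed
  obtain g where "(\<forall>F. finite F \<longrightarrow> F \<subseteq> \<Omega> \<longrightarrow> (\<exists>A h. ?P A h \<and> F \<subseteq> A \<and> (\<forall>a\<in>A. g a = h a))) \<and>
      (\<forall>y\<in>\<Omega>. \<exists>A h. ?P A h \<and> y \<in> h ` A \<and> (\<forall>a\<in>A. g a = h a))"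
    using back_and_forth[where P = ?P and X = \<Omega> and Y = \<Omega>, OF \<open>countable \<Omega>\<close> insert_not_empty
        \<open>countable \<Omega>\<close> insert_not_empty init forth_step back_step] by (rule exE)
  note limit = this
  have g: "\<exists>A h. ?P A h \<and> F \<subseteq> A \<and> (\<forall>a\<in>A. g a = h a)" if "finite F" "F \<subseteq> \<Omega>" for F
    by (rule conjunct1[OF limit, THEN spec, THEN mp, OF that(1), THEN mp, OF that(2)])
  have g_onto: "\<exists>A h. ?P A h \<and> z \<in> h ` A \<and> (\<forall>a\<in>A. g a = h a)" if "z \<in> \<Omega>" for z
    by (rule conjunct2[OF limit, THEN bspec, OF that])
  \<comment> \<open>The limit is arbitrary outside \<open>\<Omega>\<close>, whereas a permutation of
    \<open>\<Omega>\<close> has to be the identity there.\<close>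
  define g' where "g' z = (if z \<in> \<Omega> then g z else z)" for z
  have g': "g' z = g z" if "z \<in> \<Omega>" for z using that by (simp only: g'_def if_True)
  have iso_sub: "A \<subseteq> \<Omega>" "h ` A \<subseteq> \<Omega>" "inj_on h A" if "partial_iso A h" for A h
    using that unfolding partial_iso_def by simp_all
  have "inj_on g \<Omega>"
  proof (rule inj_onI)
    fix u v assume uv: "u \<in> \<Omega>" "v \<in> \<Omega>" "g u = g v"
    obtain A h where "partial_iso A h" "{u, v} \<subseteq> A" "\<forall>a\<in>A. g a = h a"
      using g[of "{u, v}"] uv by auto
    thus "u = v" using iso_sub(3)[of A h] uv(3) by (auto dest: inj_onD)
  qed
  moreover have "g ` \<Omega> = \<Omega>"
  proof (rule equalityI)
    show "g ` \<Omega> \<subseteq> \<Omega>"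
    proof (rule image_subsetI)
      fix z assume z: "z \<in> \<Omega>"
      obtain A h where "partial_iso A h" "z \<in> A" "\<forall>a\<in>A. g a = h a"
        using g[of "{z}"] z by auto
      thus "g z \<in> \<Omega>" using iso_sub(2)[of A h] by (metis image_subset_iff)
    qed
    show "\<Omega> \<subseteq> g ` \<Omega>"
    proof (rule subsetI)
      fix z assume z: "z \<in> \<Omega>"
      obtain A h a where "partial_iso A h" "z = h a" "a \<in> A" "\<forall>a\<in>A. g a = h a"
        using g_onto[OF z] by blast
      thus "z \<in> g ` \<Omega>" using iso_sub(1)[of A h] by (metis imageI subsetD)
    qed
  qed
  ultimately have "bij_betw g' \<Omega> \<Omega>"
    using g' by (subst bij_betw_cong[of \<Omega> g' g]) (simp_all only: bij_betw_def)
  hence "g' permutes \<Omega>"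
    by (rule bij_imp_permutes) (simp only: g'_def if_False)
  moreover have "\<delta> j (g' ` S) = \<delta> j S" if S: "S \<subseteq> \<Omega>" "card S = Suc k" "j < m" for S j
  proof -
    have "finite S" using S(2) card_ge_0_finite[of S] by simp
    then obtain A h where A: "partial_iso A h" "S \<subseteq> A" "\<forall>a\<in>A. g a = h a"
      using g[OF _ S(1)] by blast
    have "g' ` S = h ` S"
      using A S(1) g' by (intro image_cong) (auto simp: subset_iff)
    thus ?thesis using A S unfolding partial_iso_def by simp
  qed
  moreover have "g' x = y"
    using g[of "{x}"] x g'[OF x] by auto
  ultimately show ?thesis unfolding cocycle_auts_def by blast
qed

text \<open>All faces but one contain \<open>None\<close> and contribute zero, so around
  \<open>None\<close> the coboundary gives back the original coloring.\<close>

lemma coboundary_insert_None: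
  assumes "finite e"
  shows "\<delta> j (insert None (Some ` e)) = of_bool (j \<in> \<beta> (col e))"
proof -
  have "\<delta> j (insert None (Some ` e)) =
      color_bit j (insert None (Some ` e) - {None}) + (\<Sum>s\<in>Some ` e. color_bit j (insert None (Some ` e) - {s}))"
    unfolding coboundary_def using assms by (subst sum.insert) auto
  also have "(\<Sum>s\<in>Some ` e. color_bit j (insert None (Some ` e) - {s})) = 0"
    by (intro sum.neutral) (auto simp: color_bit_def)
  also have "insert None (Some ` e) - {None} = Some ` e" by auto
  finally show ?thesis by (simp add: color_bit_Some)
qed

lemma color_eqI:
  assumes "e \<subseteq> U" "card e = k" "e' \<subseteq> U" "card e' = k"
    "\<And>j. j < m \<Longrightarrow> (of_bool (j \<in> \<beta> (col e)) :: bit) = of_bool (j \<in> \<beta> (col e'))"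
  shows "col e = col e'"
proof -
  have r: "col e \<in> {1..n}" "col e' \<in> {1..n}" using col_range assms by blast+
  hence "\<beta> (col e) \<subseteq> {..<m}" "\<beta> (col e') \<subseteq> {..<m}"
    using bij_\<beta> by (auto simp: bij_betw_def)
  hence "\<beta> (col e) = \<beta> (col e')"
    using assms(5) by (auto simp: of_bool_eq_iff)
  thus ?thesis using r bij_\<beta> by (auto simp: bij_betw_def dest: inj_onD)
qed

text \<open>Since \<open>None\<close> is fixed and the colors in \<open>U\<close> are preserved,
  every face keeps its bit, and so the coboundary is preserved termwise.\<close>

lemma map_option_in_cocycle_auts:
  assumes u: "u \<in> color_auts"
  shows "map_option u \<in> cocycle_auts"
proof -
  have u: "u permutes U" "\<And>e. e \<subseteq> U \<Longrightarrow> card e = k \<Longrightarrow> col (u ` e) = col e"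
    using assms by (auto simp: color_auts_def)
  have injm: "inj (map_option u)"
    using permutes_inj[OF u(1)] by (rule option.inj_map)
  have "map_option u ` \<Omega> = insert None (Some ` u ` U)"
    by (simp add: image_image)
  hence "map_option u ` \<Omega> = \<Omega>" using permutes_image[OF u(1)] by simp
  hence "bij_betw (map_option u) \<Omega> \<Omega>"
    unfolding bij_betw_def using inj_on_subset[OF injm subset_UNIV] by blast
  hence perm: "map_option u permutes \<Omega>"
  proof (rule bij_imp_permutes)
    fix x assume "x \<notin> \<Omega>"
    then obtain a where "x = Some a" "a \<notin> U" by (cases x) auto
    thus "map_option u x = x" using permutes_not_in[OF u(1)] by simp
  qed
  have bit: "color_bit j (map_option u ` e) = color_bit j e" if e: "e \<subseteq> \<Omega>" "card e = k" for j e
  proof (cases "None \<in> e")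
    case True
    hence "None \<in> map_option u ` e" by force
    thus ?thesis using True by (simp add: color_bit_def)
  next
    case False
    hence "e \<subseteq> Some ` U" using e by auto
    then obtain t where t: "t \<subseteq> U" "e = Some ` t" by (meson subset_imageE)
    have "map_option u ` e = Some ` u ` t" unfolding t by (simp add: image_image)
    thus ?thesis using u(2)[OF t(1)] e(2) t(2) by (simp add: color_bit_Some card_image)
  qed
  have "\<delta> j (map_option u ` S) = \<delta> j S" if S: "S \<subseteq> \<Omega>" "card S = Suc k" for S j
  proof -
    have "\<delta> j (map_option u ` S) = (\<Sum>s\<in>S. color_bit j (map_option u ` S - {map_option u s}))"
      unfolding coboundary_def using inj_on_subset[OF injm subset_UNIV] by (simp add: sum.reindex)
    also have "\<dots> = (\<Sum>s\<in>S. color_bit j (S - {s}))"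
    proof (rule sum.cong[OF refl])
      fix s assume s: "s \<in> S"
      have "map_option u ` S - {map_option u s} = map_option u ` (S - {s})"
        using image_set_diff[OF injm, of S "{s}"] by simp
      thus "color_bit j (map_option u ` S - {map_option u s}) = color_bit j (S - {s})"
        using bit[of "S - {s}" j] S s by auto
    qed
    finally show ?thesis by (simp only: coboundary_def)
  qed
  thus ?thesis using perm by (simp add: cocycle_auts_def)
qed

text \<open>A permutation fixing \<open>None\<close> that preserves \<open>\<delta>\<close> on the
  sets through \<open>None\<close> preserves all bits of \<open>col\<close>, hence
  \<open>col\<close> itself because \<open>\<beta>\<close> is injective.\<close>

lemma stabilizer_cocycle_auts:
  "(\<lambda>g x. the (g (Some x))) ` {g \<in> cocycle_auts. g None = None} = color_auts"
proof (rule equalityI)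
  show "color_auts \<subseteq> (\<lambda>g x. the (g (Some x))) ` {g \<in> cocycle_auts. g None = None}"
  proof (rule subsetI)
    fix u assume "u \<in> color_auts"
    hence "map_option u \<in> {g \<in> cocycle_auts. g None = None}"
      using map_option_in_cocycle_auts by simp
    thus "u \<in> (\<lambda>g x. the (g (Some x))) ` {g \<in> cocycle_auts. g None = None}"
      by (rule rev_image_eqI) simp
  qed
  show "(\<lambda>g x. the (g (Some x))) ` {g \<in> cocycle_auts. g None = None} \<subseteq> color_auts"
  proof (rule image_subsetI)
    fix g assume "g \<in> {g \<in> cocycle_auts. g None = None}"
    hence g: "g permutes \<Omega>" "g None = None"
      "\<And>S j. S \<subseteq> \<Omega> \<Longrightarrow> card S = Suc k \<Longrightarrow> j < m \<Longrightarrow> \<delta> j (g ` S) = \<delta> j S"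
      by (auto simp: cocycle_auts_def)
    define u where "u x = the (g (Some x))" for x
    have some: "g (Some x) = Some (u x)" for x
      using inj_eq[OF permutes_inj[OF g(1)], of "Some x" None] g(2)
      by (cases "g (Some x)") (auto simp: u_def)
    have gu: "g ` Some ` e = Some ` u ` e" for e
      by (simp add: image_image some)
    have inju: "inj u"
    proof (rule injI)
      fix x y assume "u x = u y"
      hence "g (Some x) = g (Some y)" by (simp add: some)
      thus "x = y" using inj_eq[OF permutes_inj[OF g(1)]] by blast
    qed
    have "insert None (Some ` u ` U) = \<Omega>"
      using permutes_image[OF g(1)] by (simp add: g(2) gu)
    hence "Some ` u ` U = Some ` U" by (simp add: insert_eq_iff)
    hence "u ` U = U" by (simp add: inj_image_eq_iff)
    hence "bij_betw u U U" unfolding bij_betw_def using inj_on_subset[OF inju subset_UNIV] by blast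
    hence perm: "u permutes U"
    proof (rule bij_imp_permutes)
      fix x assume "x \<notin> U"
      hence "g (Some x) = Some x" using permutes_not_in[OF g(1)] by auto
      thus "u x = x" by (simp add: u_def)
    qed
    have "col (u ` e) = col e" if e: "e \<subseteq> U" "card e = k" for e
    proof (rule color_eqI)
      show "u ` e \<subseteq> U" using e \<open>u ` U = U\<close> by blast
      show "card (u ` e) = k" using e card_image[OF inj_on_subset[OF inju subset_UNIV]] by simp
      fix j assume j: "j < m"
      have fin: "finite e" using e(2) k_ge_2 card_ge_0_finite[of e] by simp
      have "card (insert None (Some ` e)) = Suc k"
        using fin e by (subst card_insert_disjoint) (auto simp: card_image)
      moreover have "insert None (Some ` e) \<subseteq> \<Omega>" using e by auto
      ultimately have "\<delta> j (g ` insert None (Some ` e)) = \<delta> j (insert None (Some ` e))"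
        using g(3) j by blast
      moreover have "g ` insert None (Some ` e) = insert None (Some ` u ` e)"
        by (simp add: g(2) gu)
      ultimately show "(of_bool (j \<in> \<beta> (col (u ` e))) :: bit) = of_bool (j \<in> \<beta> (col e))"
        using coboundary_insert_None[of e j] coboundary_insert_None[of "u ` e" j] fin by simp
    qed (use e in auto)
    thus "(\<lambda>x. the (g (Some x))) \<in> color_auts"
      using perm unfolding u_def[abs_def] color_auts_def by blast
  qed
qed

end

section \<open>Automorphism groups\<close>

lemma Aut_iff:
  "g \<in> Aut L M \<longleftrightarrow> g permutes universe M \<and>
     (\<forall>f\<in>fun_syms L. \<forall>xs\<in>tuples (universe M) (fun_arity L f).
        g (fun_int M f xs) = fun_int M f (map g xs)) \<and>
     (\<forall>r\<in>rel_syms L. \<forall>xs\<in>tuples (universe M) (rel_arity L r).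
        xs \<in> rel_int M r \<longleftrightarrow> map g xs \<in> rel_int M r)"
  using permutes_inj_on[of g "universe M"] permutes_image[of g "universe M"]
  by (auto simp: Aut_def isomorphism_def embedding_def)

lemma map_permutes_tuples:
  assumes "g permutes A" "xs \<in> tuples A i"
  shows "map g xs \<in> tuples A i"
  using assms permutes_image[OF assms(1)] by (auto simp: tuples_def)

lemma Aut_comp:
  assumes g: "g \<in> Aut L M" and h: "h \<in> Aut L M"
  shows "g \<circ> h \<in> Aut L M"
proof -
  have perm: "g permutes universe M" "h permutes universe M"
    using g h by (simp_all add: Aut_iff)
  have "(g \<circ> h) (fun_int M f xs) = fun_int M f (map (g \<circ> h) xs)"
    if f: "f \<in> fun_syms L" and xs: "xs \<in> tuples (universe M) (fun_arity L f)" for f xs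
  proof -
    have "h (fun_int M f xs) = fun_int M f (map h xs)"
      using h f xs unfolding Aut_iff by blast
    moreover have "g (fun_int M f (map h xs)) = fun_int M f (map g (map h xs))"
      using g f map_permutes_tuples[OF perm(2) xs] unfolding Aut_iff by blast
    ultimately show ?thesis by simp
  qed
  moreover have "xs \<in> rel_int M r \<longleftrightarrow> map (g \<circ> h) xs \<in> rel_int M r"
    if r: "r \<in> rel_syms L" and xs: "xs \<in> tuples (universe M) (rel_arity L r)" for r xs
  proof -
    have "xs \<in> rel_int M r \<longleftrightarrow> map h xs \<in> rel_int M r"
      using h r xs unfolding Aut_iff by blast
    also have "\<dots> \<longleftrightarrow> map g (map h xs) \<in> rel_int M r"
      using g r map_permutes_tuples[OF perm(2) xs] unfolding Aut_iff by blast
    finally show ?thesis by simp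
  qed
  ultimately show ?thesis
    unfolding Aut_iff using permutes_compose[OF perm(2,1)] by blast
qed

lemma Aut_inv:
  assumes g: "g \<in> Aut L M"
  shows "inv g \<in> Aut L M"
proof -
  have perm: "g permutes universe M" using g by (simp add: Aut_iff)
  have tup: "map (inv g) xs \<in> tuples (universe M) i" if "xs \<in> tuples (universe M) i" for xs i
    using permutes_inv[OF perm] that by (rule map_permutes_tuples)
  have cancel: "map g (map (inv g) xs) = xs" for xs
    using permutes_inverses(1)[OF perm] by (simp add: o_def)
  have "inv g (fun_int M f xs) = fun_int M f (map (inv g) xs)"
    if "f \<in> fun_syms L" "xs \<in> tuples (universe M) (fun_arity L f)" for f xs
  proof -
    have "g (fun_int M f (map (inv g) xs)) = fun_int M f (map g (map (inv g) xs))"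
      using g that tup unfolding Aut_iff by blast
    thus ?thesis
      unfolding cancel using permutes_inverses(2)[OF perm] by metis
  qed
  moreover have "xs \<in> rel_int M r \<longleftrightarrow> map (inv g) xs \<in> rel_int M r"
    if "r \<in> rel_syms L" "xs \<in> tuples (universe M) (rel_arity L r)" for r xs
  proof -
    have "map (inv g) xs \<in> rel_int M r \<longleftrightarrow> map g (map (inv g) xs) \<in> rel_int M r"
      using g that tup unfolding Aut_iff by blast
    thus ?thesis unfolding cancel by simp
  qed
  ultimately show ?thesis
    unfolding Aut_iff using permutes_inv[OF perm] by blast
qed

section \<open>Translation between extensions as structures and their groups\<close>

lemma transitive_extension_imp_locale:
  assumes k: "k \<ge> 2" and gen: "generic_edge_colored_hypergraph k n G"
    and ext: "transitive_extension (hypergraph_language k n) G L' M'"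
  shows "transitive_color_extension (universe G) k n (edge_color n G) (Aut L' M')"
proof -
  interpret generic_coloring "universe G" k n "edge_color n G"
    using k gen by (rule generic_coloring_generic_hypergraph)
  have univ: "universe M' = insert None (Some ` universe G)"
    and img: "(\<lambda>g x. the (g (Some x))) ` {g \<in> Aut L' M'. g None = None} = color_auts"
    using ext Aut_generic_hypergraph[OF k gen]
    by (simp_all add: transitive_extension_def one_point_extension_def)
  show ?thesis
  proof
    show "h permutes insert None (Some ` universe G)" if "h \<in> Aut L' M'" for h
      using that univ by (simp add: Aut_def)
    show "\<exists>h\<in>Aut L' M'. h x = y"
      if "x \<in> insert None (Some ` universe G)" "y \<in> insert None (Some ` universe G)" for x y
      using ext that unfolding transitive_extension_def univ by blast
    show "(\<lambda>x. the (g (Some x))) \<in> color_auts" if "g \<in> Aut L' M'" "g None = None" for g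
      unfolding img[symmetric] using that by (intro image_eqI[of _ _ g]) simp_all
    show "\<exists>g\<in>Aut L' M'. g None = None \<and> (\<forall>x\<in>universe G. g (Some x) = Some (u x))"
      if u: "u \<in> color_auts" for u
    proof -
      obtain g where g: "g \<in> Aut L' M'" "g None = None" "u = (\<lambda>x. the (g (Some x)))"
        using u unfolding img[symmetric] by blast
      \<comment> \<open>Injectivity excludes \<open>g (Some x) = None\<close>, so \<open>the\<close>
        loses no information.\<close>
      have "inj g" using g(1) permutes_inj by (auto simp: Aut_def)
      hence "g (Some x) \<noteq> None" for x
        using g(2) inj_eq[of g "Some x" None] by simp
      thus ?thesis using g by (intro bexI[of _ g]) auto
    qed
  qed (rule Aut_comp Aut_inv; assumption)+
qed

text \<open>One \<open>(k+1)\<close>-ary relation for each bit \<open>j < m\<close> records where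
  \<open>\<delta> j\<close> is 1. The infinite symbol type provides distinct names through
  \<open>\<iota>\<close>.\<close>

lemma (in binary_coloring) ex_transitive_extension:
  fixes G :: "('f, nat, 'a) fo_structure" and L :: "('f, nat) language"
  assumes inf: "infinite (UNIV :: 's set)" and U: "universe G = U" and Aut: "Aut L G = color_auts"
  shows "has_transitive_extension TYPE('g) TYPE('s) L G"
proof -
  obtain \<iota> :: "nat \<Rightarrow> 's" where \<iota>: "inj \<iota>"
    using inf infinite_countable_subset by blast
  define L' :: "('g, 's) language" where
    "L' = \<lparr>fun_syms = {}, fun_arity = (\<lambda>_. 0), rel_syms = \<iota> ` {..<m}, rel_arity = (\<lambda>_. Suc k)\<rparr>"
  define M' :: "('g, 's, 'a option) fo_structure" where
    "M' = \<lparr>universe = \<Omega>, fun_int = undefined,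
       rel_int = (\<lambda>r. {xs \<in> tuples \<Omega> (Suc k). distinct xs \<and> \<delta> (inv \<iota> r) (set xs) = 1})\<rparr>"
  have univ: "universe M' = \<Omega>" by (simp add: M'_def)
  have rel: "xs \<in> rel_int M' (\<iota> j) \<longleftrightarrow> distinct xs \<and> \<delta> j (set xs) = 1"
    if "xs \<in> tuples \<Omega> (Suc k)" for xs j
    using that \<iota> by (simp add: M'_def)
  have str: "is_structure L' M'"
    by (auto simp: is_structure_def L'_def M'_def)
  have "g \<in> Aut L' M' \<longleftrightarrow> g \<in> cocycle_auts" if perm: "g permutes \<Omega>" for g
  proof -
    have "g \<in> Aut L' M' \<longleftrightarrow>
        (\<forall>j<m. \<forall>xs\<in>tuples \<Omega> (Suc k). xs \<in> rel_int M' (\<iota> j) \<longleftrightarrow> map g xs \<in> rel_int M' (\<iota> j))"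
      unfolding Aut_iff univ using perm by (auto simp: L'_def)
    \<comment> \<open>Tuples with repetitions lie in no relation, and a bit is determined by whether
      it equals 1.\<close>
    also have "\<dots> \<longleftrightarrow> (\<forall>j<m. \<forall>xs\<in>tuples \<Omega> (Suc k). distinct xs \<longrightarrow> \<delta> j (g ` set xs) = \<delta> j (set xs))"
    proof (intro all_cong ball_cong refl)
      fix j xs assume xs: "xs \<in> tuples \<Omega> (Suc k)"
      have "distinct (map g xs) \<longleftrightarrow> distinct xs"
        using inj_on_subset[OF permutes_inj[OF perm] subset_UNIV, of "set xs"]
        by (simp add: distinct_map)
      thus "(xs \<in> rel_int M' (\<iota> j) \<longleftrightarrow> map g xs \<in> rel_int M' (\<iota> j)) \<longleftrightarrow>
          (distinct xs \<longrightarrow> \<delta> j (g ` set xs) = \<delta> j (set xs))"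
        unfolding rel[OF xs] rel[OF map_permutes_tuples[OF perm xs]] set_map
        by (cases "\<delta> j (g ` set xs)"; cases "\<delta> j (set xs)") auto
    qed
    also have "\<dots> \<longleftrightarrow> (\<forall>S\<subseteq>\<Omega>. card S = Suc k \<longrightarrow> (\<forall>j<m. \<delta> j (g ` S) = \<delta> j S))"
    proof (intro iffI allI impI ballI)
      fix S j assume *: "\<forall>j<m. \<forall>xs\<in>tuples \<Omega> (Suc k). distinct xs \<longrightarrow> \<delta> j (g ` set xs) = \<delta> j (set xs)"
        and S: "S \<subseteq> \<Omega>" "card S = Suc k" and j: "j < m"
      obtain xs where xs: "set xs = S" "distinct xs"
        using finite_distinct_list[of S] card_ge_0_finite[of S] S(2) by auto
      hence "xs \<in> tuples \<Omega> (Suc k)"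
        using S distinct_card[OF xs(2)] by (simp add: tuples_def)
      thus "\<delta> j (g ` S) = \<delta> j S" using * j xs by blast
    next
      fix j xs assume *: "\<forall>S\<subseteq>\<Omega>. card S = Suc k \<longrightarrow> (\<forall>j<m. \<delta> j (g ` S) = \<delta> j S)"
        and j: "j < m" and xs: "xs \<in> tuples \<Omega> (Suc k)" "distinct xs"
      have "set xs \<subseteq> \<Omega>" "card (set xs) = Suc k"
        using xs distinct_card[OF xs(2)] by (simp_all add: tuples_def)
      thus "\<delta> j (g ` set xs) = \<delta> j (set xs)" using * j by blast
    qed
    finally show ?thesis using perm by (simp add: cocycle_auts_def)
  qed
  moreover have "g permutes \<Omega>" if "g \<in> Aut L' M' \<or> g \<in> cocycle_auts" for g
    using that univ by (auto simp: Aut_def cocycle_auts_def)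
  ultimately have Aut': "Aut L' M' = cocycle_auts" by blast
  have "one_point_extension L G L' M'"
    unfolding one_point_extension_def Aut' U univ Aut using str stabilizer_cocycle_auts by simp
  hence "transitive_extension L G L' M'"
    unfolding transitive_extension_def Aut' univ using cocycle_auts_transitive by simp
  thus ?thesis
    unfolding has_transitive_extension_def by blast
qed

theorem theorem1:
  fixes k n :: nat and G :: "('f, nat, 'a) fo_structure"
  assumes "k \<ge> 2" and "n \<ge> 1"
    and "generic_edge_colored_hypergraph k n G"
    and "infinite (UNIV :: 's set)"
  shows "has_transitive_extension TYPE('g) TYPE('s) (hypergraph_language k n) G \<longleftrightarrow>
         (\<exists>m. n = 2 ^ m)"
proof
  assume "has_transitive_extension TYPE('g) TYPE('s) (hypergraph_language k n) G"
  then obtain L' :: "('g, 's) language" and M'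
    where "transitive_extension (hypergraph_language k n) G L' M'"
    unfolding has_transitive_extension_def by blast
  then interpret transitive_color_extension "universe G" k n "edge_color n G" "Aut L' M'"
    by (rule transitive_extension_imp_locale[OF assms(1,3)])
  show "\<exists>m. n = 2 ^ m"
    using assms(2) by (rule power_of_two)
next
  assume "\<exists>m. n = 2 ^ m"
  then obtain m where m: "n = 2 ^ m" by blast
  \<comment> \<open>There are as many colors as bit vectors of length \<open>m\<close>, and any
    bijection can serve as \<open>\<beta>\<close>.\<close>
  have "card {1..n} = card (Pow {..<m})"
    by (simp add: card_Pow m)
  then obtain \<beta> where \<beta>: "bij_betw \<beta> {1..n} (Pow {..<m})"
    using finite_same_card_bij[of "{1..n}" "Pow {..<m}"] by auto
  interpret generic_coloring "universe G" k n "edge_color n G"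
    using assms(1,3) by (rule generic_coloring_generic_hypergraph)
  interpret binary_coloring "universe G" k n "edge_color n G" m \<beta>
    by unfold_locales (rule \<beta>)
  show "has_transitive_extension TYPE('g) TYPE('s) (hypergraph_language k n) G"
    using ex_transitive_extension[OF assms(4) refl Aut_generic_hypergraph[OF assms(1,3)]] .
qed

end
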